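(* Let $n,m\in\mathbb{N}$, let $\mathbf q$ and $\mathbf q'$ be multiplicatively anti-symmetric complex matrices of sizes $(n+1)\times(n+1)$ and $(m+1)\times(m+1)$, let $N=(n+1)(m+1)-1$, and let $\mathcal{A}^N_{\mathbf g}$ be the quantum space on generators $z_{i\alpha}$ ($0\le i\le n$, $0\le\alpha\le m$) with matrix $g_{i\alpha,j\beta}=q_{ij}q'_{\alpha\beta}$. Let $s_{n,m}:\mathcal{A}^N_{\mathbf g}\to\mathcal{A}^n_{\mathbf q}\otimes\mathcal{A}^m_{\mathbf q'}$ be the Segre map, i.e. the $\mathbb{C}$-algebra homomorphism with $z_{i\alpha}\mapsto x_i\otimes y_\alpha$. Then the set $$\mathcal{R}^{\mathrm s}_{\mathbf q,\mathbf q'}:=\{\,z_{i\beta}z_{j\alpha}-q'_{\beta\alpha}\,z_{i\alpha}z_{j\beta}\ \mid\ 0\le i<j\le n,\ 0\le\alpha<\beta\le m\}\subset\mathcal{A}^N_{\mathbf g},$$ consisting of $\binom{n+1}{2}\binom{m+1}{2}$ quadratic binomials, is a reduced Gröbner basis for the kernel of the Segre map $s_{n,m}$.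
   Context: A square complex matrix $\mathbf q=\|q_{ij}\|$ is multiplicatively anti-symmetric if all $q_{ij}\in\mathbb{C}^\times$, $q_{ji}=q_{ij}^{-1}$ and $q_{ii}=1$. The quantum spaces are $\mathcal{A}^n_{\mathbf q}=\mathbb{C}\langle x_0,\dots,x_n\rangle/(x_jx_i-q_{ji}x_ix_j\mid 0\le i<j\le n)$ and $\mathcal{A}^m_{\mathbf q'}=\mathbb{C}\langle y_0,\dots,y_m\rangle/(y_\beta y_\alpha-q'_{\beta\alpha}y_\alpha y_\beta\mid 0\le\alpha<\beta\le m)$; the tensor product is the usual tensor product of algebras over $\mathbb{C}$. Order $Z=\{z_{i\alpha}\}$ by $z_{i\alpha}\prec z_{j\beta}$ iff $i<j$, or $i=j$ and $\alpha<\beta$. Then $\mathcal{A}^N_{\mathbf g}=\mathbb{C}\langle Z\rangle/(z_{j\beta}z_{i\alpha}-g_{j\beta,i\alpha}z_{i\alpha}z_{j\beta}\mid z_{j\beta}\succ z_{i\alpha})$, identified as a vector space with the span $\mathbb{C}\mathcal{T}(Z)$ of the set $\mathcal{T}(Z)$ of ordered monomials $z_{00}^{k_{00}}z_{01}^{k_{01}}\cdots z_{nm}^{k_{nm}}$ (variables in increasing order), which is a basis. The order $\prec$ is extended degree-lexicographically to words in $Z$ and restricted to $\mathcal{T}(Z)$; $\mathbf{LM}(f)$ is the leading monomial of a nonzero $f\in\mathbb{C}\mathcal{T}(Z)$. For $u,v\in\mathcal{T}(Z)$, $u\star v$ is the ordered monomial whose exponent vector is the sum of those of $u$ and $v$.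 A set $F\subset\mathfrak K$ of monic elements is a Gröbner basis of a two-sided ideal $\mathfrak K$ of $\mathcal{A}^N_{\mathbf g}$ if for every nonzero $h\in\mathfrak K$ there are $f\in F$ and $u\in\mathcal{T}(Z)$ with $\mathbf{LM}(h)=u\star\mathbf{LM}(f)$. It is minimal if no $F\setminus\{f\}$ ($f\in F$) is a Gröbner basis of $\mathfrak K$, and reduced if it is minimal and each $f\in F$ is a linear combination of ordered monomials that are normal modulo $F\setminus\{f\}$, i.e. not of the form $u\star\mathbf{LM}(g)$ with $g\in F\setminus\{f\}$. *)

theory Defs
  imports Complex_Main
    "HOL-Algebra.QuotRing"
    "HOL-Algebra.Module"
    "HOL-Library.Poly_Mapping"
    "HOL-Library.Product_Lexorder"
begin

section \<open>Complex algebras\<close>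

text \<open>An algebra over the complex numbers is carried by the ring-with-scalar-multiplication record
  of \<open>HOL-Algebra\<close>; the locale \<open>algebra\<close> of that library is not used because it is restricted to
  commutative algebras.\<close>

type_synonym 'a calg = "(complex, 'a) module"

definition calg_hom :: "'a calg \<Rightarrow> 'b calg \<Rightarrow> ('a \<Rightarrow> 'b) set" where
  "calg_hom A B = {h \<in> ring_hom A B. \<forall>c. \<forall>x\<in>carrier A. h (c \<odot>\<^bsub>A\<^esub> x) = c \<odot>\<^bsub>B\<^esub> h x}"

definition quotient_algebra :: "'a calg \<Rightarrow> 'a set \<Rightarrow> 'a set calg" where
  "quotient_algebra A I =
    \<lparr>carrier = carrier (A Quot I), mult = mult (A Quot I), one = one (A Quot I),
     zero = zero (A Quot I), add = add (A Quot I),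
     smult = (\<lambda>c X. (\<Union>x\<in>X. I +>\<^bsub>A\<^esub> (c \<odot>\<^bsub>A\<^esub> x)))\<rparr>"

text \<open>The monoid algebra: formal linear combinations of the elements of \<open>G\<close>, with the bilinear
  extension of the multiplication of \<open>G\<close>.\<close>

definition monoid_algebra :: "('a, 'm) monoid_scheme \<Rightarrow> ('a \<Rightarrow>\<^sub>0 complex) calg" where
  "monoid_algebra G =
    \<lparr>carrier = {p. Poly_Mapping.keys p \<subseteq> carrier G},
     mult = (\<lambda>p q. \<Sum>a\<in>Poly_Mapping.keys p. \<Sum>b\<in>Poly_Mapping.keys q.
       Poly_Mapping.single (a \<otimes>\<^bsub>G\<^esub> b) (Poly_Mapping.lookup p a * Poly_Mapping.lookup q b)),
     one = Poly_Mapping.single \<one>\<^bsub>G\<^esub> 1,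
     zero = 0,
     add = (+),
     smult = (\<lambda>c p. Poly_Mapping.map ((*) c) p)\<rparr>"

definition free_algebra :: "'x set \<Rightarrow> ('x list \<Rightarrow>\<^sub>0 complex) calg" where
  "free_algebra X = monoid_algebra \<lparr>carrier = lists X, mult = (@), one = []\<rparr>"


section \<open>Tensor product of algebras\<close>

text \<open>The tensor product is the free vector space on \<open>carrier A \<times> carrier B\<close> modulo the linear span
  of the bilinearity relations. The free vector space is taken with the multiplication
  \<open>(a, b) (a', b') = (a a', b b')\<close>, for which this span is a two-sided ideal
  (\<open>tensor_ideal_ideal\<close> below).\<close>

definition tensor_relations :: "'a calg \<Rightarrow> 'b calg \<Rightarrow> ('a \<times> 'b \<Rightarrow>\<^sub>0 complex) set" where
  "tensor_relations A B =
     {Poly_Mapping.single (a \<oplus>\<^bsub>A\<^esub> a', b) 1 - Poly_Mapping.single (a, b) 1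
        - Poly_Mapping.single (a', b) 1 | a a' b. a \<in> carrier A \<and> a' \<in> carrier A \<and> b \<in> carrier B} \<union>
     {Poly_Mapping.single (a, b \<oplus>\<^bsub>B\<^esub> b') 1 - Poly_Mapping.single (a, b) 1
        - Poly_Mapping.single (a, b') 1 | a b b'. a \<in> carrier A \<and> b \<in> carrier B \<and> b' \<in> carrier B} \<union>
     {Poly_Mapping.single (c \<odot>\<^bsub>A\<^esub> a, b) 1 - Poly_Mapping.single (a, b) c
        | c a b. a \<in> carrier A \<and> b \<in> carrier B} \<union>
     {Poly_Mapping.single (a, c \<odot>\<^bsub>B\<^esub> b) 1 - Poly_Mapping.single (a, b) c
        | c a b. a \<in> carrier A \<and> b \<in> carrier B}"

definition tensor_ideal :: "'a calg \<Rightarrow> 'b calg \<Rightarrow> ('a \<times> 'b \<Rightarrow>\<^sub>0 complex) set" where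
  "tensor_ideal A B =
     (\<lambda>W. additive_subgroup W (monoid_algebra (A \<times>\<times> B)) \<and>
          (\<forall>c. \<forall>p\<in>W. c \<odot>\<^bsub>monoid_algebra (A \<times>\<times> B)\<^esub> p \<in> W))
       hull (tensor_relations A B)"

definition tensor_algebra :: "'a calg \<Rightarrow> 'b calg \<Rightarrow> ('a \<times> 'b \<Rightarrow>\<^sub>0 complex) set calg" where
  "tensor_algebra A B = quotient_algebra (monoid_algebra (A \<times>\<times> B)) (tensor_ideal A B)"

definition pure_tensor :: "'a calg \<Rightarrow> 'b calg \<Rightarrow> 'a \<Rightarrow> 'b \<Rightarrow> ('a \<times> 'b \<Rightarrow>\<^sub>0 complex) set" where
  "pure_tensor A B a b =
     tensor_ideal A B +>\<^bsub>monoid_algebra (A \<times>\<times> B)\<^esub> Poly_Mapping.single (a, b) 1"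


section \<open>Quantum spaces\<close>

definition mult_antisym :: "nat \<Rightarrow> (nat \<Rightarrow> nat \<Rightarrow> complex) \<Rightarrow> bool" where
  "mult_antisym n q \<longleftrightarrow>
     (\<forall>i\<le>n. \<forall>j\<le>n. q i j \<noteq> 0 \<and> q j i = inverse (q i j)) \<and> (\<forall>i\<le>n. q i i = 1)"

definition quantum_ideal :: "'x::linorder set \<Rightarrow> ('x \<Rightarrow> 'x \<Rightarrow> complex) \<Rightarrow> ('x list \<Rightarrow>\<^sub>0 complex) set" where
  "quantum_ideal X q =
     Idl\<^bsub>free_algebra X\<^esub> {Poly_Mapping.single [j, i] 1 - Poly_Mapping.single [i, j] (q j i)
       | i j. i \<in> X \<and> j \<in> X \<and> i < j}"

definition quantum_space :: "'x::linorder set \<Rightarrow> ('x \<Rightarrow> 'x \<Rightarrow> complex) \<Rightarrow> ('x list \<Rightarrow>\<^sub>0 complex) set calg" where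
  "quantum_space X q = quotient_algebra (free_algebra X) (quantum_ideal X q)"

definition quantum_gen :: "'x::linorder set \<Rightarrow> ('x \<Rightarrow> 'x \<Rightarrow> complex) \<Rightarrow> 'x \<Rightarrow> ('x list \<Rightarrow>\<^sub>0 complex) set" where
  "quantum_gen X q x = quantum_ideal X q +>\<^bsub>free_algebra X\<^esub> Poly_Mapping.single [x] 1"


section \<open>Groebner bases in quantum spaces\<close>

text \<open>An ordered monomial is written as a word with weakly increasing letters.\<close>

definition ordered_monomials :: "'x::linorder set \<Rightarrow> 'x list set" where
  "ordered_monomials X = {w \<in> lists X. sorted w}"

text \<open>The exponent vector of \<open>star u v\<close> is the sum of those of \<open>u\<close> and \<open>v\<close>.\<close>

definition star :: "'x::linorder list \<Rightarrow> 'x list \<Rightarrow> 'x list" where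
  "star u v = sort (u @ v)"

definition deglex :: "'x::linorder list rel" where
  "deglex = lenlex {(x, y). x < y}"

text \<open>The representative of a residue class \<open>h\<close> in the span of the ordered monomials; it exists and
  is unique since the ordered monomials form a basis of the quantum space.\<close>

definition ordered_form :: "'x::linorder set \<Rightarrow> ('x list \<Rightarrow>\<^sub>0 complex) set \<Rightarrow> ('x list \<Rightarrow>\<^sub>0 complex)" where
  "ordered_form X h = (THE p. p \<in> h \<and> Poly_Mapping.keys p \<subseteq> ordered_monomials X)"

definition leading_monomial :: "'x::linorder set \<Rightarrow> ('x list \<Rightarrow>\<^sub>0 complex) set \<Rightarrow> 'x list" where
  "leading_monomial X h =
     (THE w. w \<in> Poly_Mapping.keys (ordered_form X h) \<and>
        (\<forall>v\<in>Poly_Mapping.keys (ordered_form X h). v \<noteq> w \<longrightarrow> (v, w) \<in> deglex))"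

definition monic :: "'x::linorder set \<Rightarrow> ('x \<Rightarrow> 'x \<Rightarrow> complex) \<Rightarrow> ('x list \<Rightarrow>\<^sub>0 complex) set \<Rightarrow> bool" where
  "monic X q f \<longleftrightarrow> f \<noteq> \<zero>\<^bsub>quantum_space X q\<^esub> \<and>
     Poly_Mapping.lookup (ordered_form X f) (leading_monomial X f) = 1"

definition groebner_basis :: "'x::linorder set \<Rightarrow> ('x \<Rightarrow> 'x \<Rightarrow> complex) \<Rightarrow>
    ('x list \<Rightarrow>\<^sub>0 complex) set set \<Rightarrow> ('x list \<Rightarrow>\<^sub>0 complex) set set \<Rightarrow> bool" where
  "groebner_basis X q K F \<longleftrightarrow>
     ideal K (quantum_space X q) \<and> F \<subseteq> K \<and> (\<forall>f\<in>F. monic X q f) \<and>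
     (\<forall>h\<in>K. h \<noteq> \<zero>\<^bsub>quantum_space X q\<^esub> \<longrightarrow>
        (\<exists>f\<in>F. \<exists>u\<in>ordered_monomials X. leading_monomial X h = star u (leading_monomial X f)))"

definition minimal_groebner_basis :: "'x::linorder set \<Rightarrow> ('x \<Rightarrow> 'x \<Rightarrow> complex) \<Rightarrow>
    ('x list \<Rightarrow>\<^sub>0 complex) set set \<Rightarrow> ('x list \<Rightarrow>\<^sub>0 complex) set set \<Rightarrow> bool" where
  "minimal_groebner_basis X q K F \<longleftrightarrow>
     groebner_basis X q K F \<and> (\<forall>f\<in>F. \<not> groebner_basis X q K (F - {f}))"

definition normal_modulo :: "'x::linorder set \<Rightarrow> ('x list \<Rightarrow>\<^sub>0 complex) set set \<Rightarrow> 'x list \<Rightarrow> bool" where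
  "normal_modulo X F w \<longleftrightarrow>
     w \<in> ordered_monomials X \<and> \<not> (\<exists>u\<in>ordered_monomials X. \<exists>g\<in>F. w = star u (leading_monomial X g))"

definition reduced_groebner_basis :: "'x::linorder set \<Rightarrow> ('x \<Rightarrow> 'x \<Rightarrow> complex) \<Rightarrow>
    ('x list \<Rightarrow>\<^sub>0 complex) set set \<Rightarrow> ('x list \<Rightarrow>\<^sub>0 complex) set set \<Rightarrow> bool" where
  "reduced_groebner_basis X q K F \<longleftrightarrow>
     minimal_groebner_basis X q K F \<and>
     (\<forall>f\<in>F. \<forall>w\<in>Poly_Mapping.keys (ordered_form X f). normal_modulo X (F - {f}) w)"

definition quadratic_binomial :: "'x::linorder set \<Rightarrow> ('x list \<Rightarrow>\<^sub>0 complex) set \<Rightarrow> bool" where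
  "quadratic_binomial X f \<longleftrightarrow>
     card (Poly_Mapping.keys (ordered_form X f)) = 2 \<and>
     (\<forall>w\<in>Poly_Mapping.keys (ordered_form X f). length w = 2)"


section \<open>The Segre map\<close>

text \<open>The library order on \<open>nat \<times> nat\<close> is the lexicographic one, so the quantum space below
  is presented with respect to the required order of the \<open>z\<close> generators.\<close>

definition segre_index :: "nat \<Rightarrow> nat \<Rightarrow> (nat \<times> nat) set" where
  "segre_index n m = {..n} \<times> {..m}"

definition segre_matrix :: "(nat \<Rightarrow> nat \<Rightarrow> complex) \<Rightarrow> (nat \<Rightarrow> nat \<Rightarrow> complex) \<Rightarrow>
    nat \<times> nat \<Rightarrow> nat \<times> nat \<Rightarrow> complex" where
  "segre_matrix q q' = (\<lambda>(i, \<alpha>) (j, \<beta>). q i j * q' \<alpha> \<beta>)"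

abbreviation segre_source :: "nat \<Rightarrow> nat \<Rightarrow> (nat \<Rightarrow> nat \<Rightarrow> complex) \<Rightarrow> (nat \<Rightarrow> nat \<Rightarrow> complex) \<Rightarrow>
    ((nat \<times> nat) list \<Rightarrow>\<^sub>0 complex) set calg" where
  "segre_source n m q q' \<equiv> quantum_space (segre_index n m) (segre_matrix q q')"

abbreviation segre_gen :: "nat \<Rightarrow> nat \<Rightarrow> (nat \<Rightarrow> nat \<Rightarrow> complex) \<Rightarrow> (nat \<Rightarrow> nat \<Rightarrow> complex) \<Rightarrow>
    nat \<Rightarrow> nat \<Rightarrow> ((nat \<times> nat) list \<Rightarrow>\<^sub>0 complex) set" where
  "segre_gen n m q q' i \<alpha> \<equiv> quantum_gen (segre_index n m) (segre_matrix q q') (i, \<alpha>)"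

abbreviation segre_target :: "nat \<Rightarrow> nat \<Rightarrow> (nat \<Rightarrow> nat \<Rightarrow> complex) \<Rightarrow> (nat \<Rightarrow> nat \<Rightarrow> complex) \<Rightarrow>
    ((nat list \<Rightarrow>\<^sub>0 complex) set \<times> (nat list \<Rightarrow>\<^sub>0 complex) set \<Rightarrow>\<^sub>0 complex) set calg" where
  "segre_target n m q q' \<equiv> tensor_algebra (quantum_space {..n} q) (quantum_space {..m} q')"

text \<open>Extensionality only fixes the junk values outside the carrier, so that the map is unique as a
  total function (\<open>segre_map_unique\<close> below).\<close>

definition is_segre_map where
  "is_segre_map n m q q' s \<longleftrightarrow>
     s \<in> calg_hom (segre_source n m q q') (segre_target n m q q') \<and>
     s \<in> extensional (carrier (segre_source n m q q')) \<and>
     (\<forall>i\<le>n. \<forall>\<alpha>\<le>m. s (segre_gen n m q q' i \<alpha>) =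
        pure_tensor (quantum_space {..n} q) (quantum_space {..m} q')
          (quantum_gen {..n} q i) (quantum_gen {..m} q' \<alpha>))"

definition segre_map where
  "segre_map n m q q' = (THE s. is_segre_map n m q q' s)"

definition segre_relations :: "nat \<Rightarrow> nat \<Rightarrow> (nat \<Rightarrow> nat \<Rightarrow> complex) \<Rightarrow> (nat \<Rightarrow> nat \<Rightarrow> complex) \<Rightarrow>
    ((nat \<times> nat) list \<Rightarrow>\<^sub>0 complex) set set" where
  "segre_relations n m q q' =
     {segre_gen n m q q' i \<beta> \<otimes>\<^bsub>segre_source n m q q'\<^esub> segre_gen n m q q' j \<alpha>
        \<ominus>\<^bsub>segre_source n m q q'\<^esub>
      (q' \<beta> \<alpha> \<odot>\<^bsub>segre_source n m q q'\<^esub>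
        (segre_gen n m q q' i \<alpha> \<otimes>\<^bsub>segre_source n m q q'\<^esub> segre_gen n m q q' j \<beta>))
      | i j \<alpha> \<beta>. i < j \<and> j \<le> n \<and> \<alpha> < \<beta> \<and> \<beta> \<le> m}"

section \<open>Well-definedness\<close>

text \<open>The algebras above satisfy the algebra axioms and the Segre map exists and is unique.\<close>

locale calgebra = ring A for A :: "'a calg" (structure) +
  assumes sm_closed [simp, intro]: "x \<in> carrier A \<Longrightarrow> c \<odot> x \<in> carrier A"
    and sm_radd: "\<lbrakk>x \<in> carrier A; y \<in> carrier A\<rbrakk> \<Longrightarrow> c \<odot> (x \<oplus> y) = c \<odot> x \<oplus> c \<odot> y"
    and sm_ladd: "x \<in> carrier A \<Longrightarrow> (c + d) \<odot> x = c \<odot> x \<oplus> d \<odot> x"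
    and sm_assoc: "x \<in> carrier A \<Longrightarrow> (c * d) \<odot> x = c \<odot> (d \<odot> x)"
    and sm_one [simp]: "x \<in> carrier A \<Longrightarrow> 1 \<odot> x = x"
    and sm_ml: "\<lbrakk>x \<in> carrier A; y \<in> carrier A\<rbrakk> \<Longrightarrow> (c \<odot> x) \<otimes> y = c \<odot> (x \<otimes> y)"
    and sm_mr: "\<lbrakk>x \<in> carrier A; y \<in> carrier A\<rbrakk> \<Longrightarrow> x \<otimes> (c \<odot> y) = c \<odot> (x \<otimes> y)"
begin

lemma sm_0 [simp]: assumes "x \<in> carrier A" shows "0 \<odot> x = \<zero>"
proof -
  have "0 \<odot> x \<oplus> 0 \<odot> x = 0 \<odot> x" using sm_ladd[OF assms, of 0 0] by simp
  then show ?thesis using assms by (metis add.l_cancel_one sm_closed)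
qed

lemma sm_zero [simp]: "c \<odot> \<zero> = \<zero>"
  by (metis mult_zero_right sm_0 sm_assoc zero_closed)

lemma sm_uminus: assumes "x \<in> carrier A" shows "(- 1) \<odot> x = \<ominus> x"
proof -
  have "(- 1) \<odot> x \<oplus> x = \<zero>" using sm_ladd[OF assms, of "-1" 1] assms by simp
  then show ?thesis using assms by (metis minus_equality sm_closed)
qed

lemma sm_eq_mult: "x \<in> carrier A \<Longrightarrow> c \<odot> x = (c \<odot> \<one>) \<otimes> x"
  by (simp add: sm_ml)

lemma ideal_sm:
  assumes "ideal I A" "x \<in> I" shows "c \<odot> x \<in> I"
  using ideal.I_l_closed[OF assms, of "c \<odot> \<one>"] sm_eq_mult[of x] ideal.Icarr[OF assms] by simp

end

lemma calg_homI:
  assumes "\<And>x. x \<in> carrier A \<Longrightarrow> h x \<in> carrier B"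
    "\<And>x y. \<lbrakk>x \<in> carrier A; y \<in> carrier A\<rbrakk> \<Longrightarrow> h (x \<otimes>\<^bsub>A\<^esub> y) = h x \<otimes>\<^bsub>B\<^esub> h y"
    "\<And>x y. \<lbrakk>x \<in> carrier A; y \<in> carrier A\<rbrakk> \<Longrightarrow> h (x \<oplus>\<^bsub>A\<^esub> y) = h x \<oplus>\<^bsub>B\<^esub> h y"
    "h \<one>\<^bsub>A\<^esub> = \<one>\<^bsub>B\<^esub>"
    "\<And>c x. x \<in> carrier A \<Longrightarrow> h (c \<odot>\<^bsub>A\<^esub> x) = c \<odot>\<^bsub>B\<^esub> h x"
  shows "h \<in> calg_hom A B"
  using assms unfolding calg_hom_def ring_hom_def by auto

lemma calg_homD:
  assumes "h \<in> calg_hom A B"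
  shows "\<And>x. x \<in> carrier A \<Longrightarrow> h x \<in> carrier B"
    "\<And>x y. \<lbrakk>x \<in> carrier A; y \<in> carrier A\<rbrakk> \<Longrightarrow> h (x \<otimes>\<^bsub>A\<^esub> y) = h x \<otimes>\<^bsub>B\<^esub> h y"
    "\<And>x y. \<lbrakk>x \<in> carrier A; y \<in> carrier A\<rbrakk> \<Longrightarrow> h (x \<oplus>\<^bsub>A\<^esub> y) = h x \<oplus>\<^bsub>B\<^esub> h y"
    "h \<one>\<^bsub>A\<^esub> = \<one>\<^bsub>B\<^esub>"
    "\<And>c x. x \<in> carrier A \<Longrightarrow> h (c \<odot>\<^bsub>A\<^esub> x) = c \<odot>\<^bsub>B\<^esub> h x"
  using assms unfolding calg_hom_def ring_hom_def by auto

lemma calg_hom_comp: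
  assumes "h \<in> calg_hom A B" "k \<in> calg_hom B C" shows "k \<circ> h \<in> calg_hom A C"
  by (rule calg_homI) (simp_all add: calg_homD[OF assms(1)] calg_homD[OF assms(2)])

lemma calg_hom_ring:
  assumes "calgebra A" "calgebra B" "h \<in> calg_hom A B"
  shows "ring_hom_ring A B h"
  using assms by (auto intro!: ring_hom_ringI2 simp: calg_hom_def calgebra_def)


subsection \<open>Quotients\<close>

lemma ring_transfer:
  assumes "ring R" "carrier S = carrier R" "mult S = mult R" "one S = one R"
    "zero S = zero R" "add S = add R"
  shows "ring S"
proof -
  interpret ring R by fact
  show ?thesis
    by (intro ringI abelian_groupI monoidI)
      (auto simp: assms(2-) m_assoc a_assoc l_distr r_distr a_comm add.m_lcomm intro!: bexI[of _ "\<ominus>\<^bsub>R\<^esub> _"] l_neg)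
qed

context
  fixes A :: "'a calg" (structure) and I
  assumes A: "calgebra A" and I: "ideal I A"
begin

interpretation calgebra A by fact
interpretation ideal I A by fact

lemma quot_carrier: "carrier (quotient_algebra A I) = (\<lambda>x. I +> x) ` carrier A"
  by (auto simp: quotient_algebra_def FactRing_def A_RCOSETS_def')

lemma quot_zero: "\<zero>\<^bsub>quotient_algebra A I\<^esub> = I +> \<zero>"
  by (simp add: quotient_algebra_def FactRing_def a_rcos_zero zero_closed I
      additive_subgroup.zero_closed additive_subgroup_axioms)

lemma quot_one: "\<one>\<^bsub>quotient_algebra A I\<^esub> = I +> \<one>"
  by (simp add: quotient_algebra_def FactRing_def)

lemma quot_add: "\<lbrakk>x \<in> carrier A; y \<in> carrier A\<rbrakk> \<Longrightarrow>
    (I +> x) \<oplus>\<^bsub>quotient_algebra A I\<^esub> (I +> y) = I +> (x \<oplus> y)"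
  by (simp add: quotient_algebra_def FactRing_def a_rcos_sum)

lemma quot_mult: "\<lbrakk>x \<in> carrier A; y \<in> carrier A\<rbrakk> \<Longrightarrow>
    (I +> x) \<otimes>\<^bsub>quotient_algebra A I\<^esub> (I +> y) = I +> (x \<otimes> y)"
  by (simp add: quotient_algebra_def FactRing_def rcoset_mult_add)

lemma quot_eq_iff: "\<lbrakk>x \<in> carrier A; y \<in> carrier A\<rbrakk> \<Longrightarrow> I +> x = I +> y \<longleftrightarrow> x \<ominus> y \<in> I"
  using quotient_eq_iff_same_a_r_cos[OF I] by simp

lemma quot_self: "x \<in> carrier A \<Longrightarrow> x \<in> I +> x"
  using additive_subgroup.zero_closed[OF additive_subgroup_axioms]
  by (force simp: a_r_coset_def' )

lemma quot_memD:
  assumes "x \<in> carrier A" "y \<in> I +> x" shows "y \<in> carrier A" "I +> y = I +> x"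
proof -
  obtain i where i: "i \<in> I" "y = i \<oplus> x" using assms by (auto simp: a_r_coset_def')
  then show y: "y \<in> carrier A" using assms Icarr by auto
  have "y \<ominus> x = i" using i assms Icarr[OF i(1)] by (simp add: minus_eq a_assoc r_neg)
  then show "I +> y = I +> x" using i y assms by (simp add: quot_eq_iff)
qed

lemma quot_sm:
  assumes "x \<in> carrier A"
  shows "c \<odot>\<^bsub>quotient_algebra A I\<^esub> (I +> x) = I +> (c \<odot> x)"
proof -
  have "I +> (c \<odot> y) = I +> (c \<odot> x)" if y: "y \<in> I +> x" for y
  proof -
    have yc: "y \<in> carrier A" and e: "I +> y = I +> x" using quot_memD[OF assms y] by auto
    have "y \<ominus> x \<in> I" using e yc assms quot_eq_iff by simp
    then have "c \<odot> (y \<ominus> x) \<in> I" by (rule ideal_sm[OF I])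
    moreover have "c \<odot> (y \<ominus> x) = c \<odot> y \<ominus> c \<odot> x"
      using yc assms by (simp add: minus_eq sm_radd flip: sm_uminus sm_assoc)
    ultimately show ?thesis using yc assms by (simp add: quot_eq_iff)
  qed
  then have "(\<Union>y\<in>I +> x. I +> (c \<odot> y)) = (\<Union>y\<in>I +> x. I +> (c \<odot> x))"
    by (intro SUP_cong) auto
  moreover have "I +> x \<noteq> {}" using quot_self[OF assms] by blast
  ultimately show ?thesis by (simp add: quotient_algebra_def)
qed

lemma quot_calgebra: "calgebra (quotient_algebra A I)"
proof -
  have r: "ring (quotient_algebra A I)"
    by (rule ring_transfer[OF quotient_is_ring]) (simp_all add: quotient_algebra_def)
  show ?thesis
    apply (intro calgebra.intro r calgebra_axioms.intro; (unfold quot_carrier)?; (elim imageE)?; hypsubst?)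
    subgoal by (simp add: quot_sm)
    subgoal by (simp add: quot_sm quot_add sm_radd)
    subgoal by (simp add: quot_sm quot_add sm_ladd)
    subgoal by (simp add: quot_sm sm_assoc)
    subgoal by (simp add: quot_sm)
    subgoal by (simp add: quot_sm quot_mult sm_ml)
    subgoal by (simp add: quot_sm quot_mult sm_mr)
    done
qed

lemma quot_proj: "(\<lambda>x. I +> x) \<in> calg_hom A (quotient_algebra A I)"
  by (rule calg_homI) (auto simp: quot_carrier quot_add quot_mult quot_sm quot_one)

lemma quot_lift:
  assumes B: "calgebra B" and h: "h \<in> calg_hom A B" and k: "I \<subseteq> a_kernel A B h"
  obtains s where "s \<in> calg_hom (quotient_algebra A I) B"
    "s \<in> extensional (carrier (quotient_algebra A I))"
    "\<And>x. x \<in> carrier A \<Longrightarrow> s (I +> x) = h x"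
proof -
  interpret h: ring_hom_ring A B h by (rule calg_hom_ring[OF A B h])
  have wd: "h x = h y" if "x \<in> carrier A" "y \<in> carrier A" "I +> x = I +> y" for x y
  proof -
    have "x \<ominus> y \<in> a_kernel A B h" using that k quot_eq_iff by auto
    then have z: "h (x \<ominus> y) = \<zero>\<^bsub>B\<^esub>" unfolding a_kernel_def' by blast
    have "x = (x \<ominus> y) \<oplus> y" using that by (simp add: minus_eq a_assoc l_neg)
    then have "h x = h (x \<ominus> y) \<oplus>\<^bsub>B\<^esub> h y" using that by (metis h.hom_add minus_closed)
    then show ?thesis using z that by simp
  qed
  define s where "s = restrict (\<lambda>Y. h (SOME x. x \<in> carrier A \<and> Y = I +> x))
    (carrier (quotient_algebra A I))"
  have s: "s (I +> x) = h x" if "x \<in> carrier A" for x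
  proof -
    have "\<exists>y. y \<in> carrier A \<and> I +> x = I +> y" using that by auto
    from someI_ex[OF this] show ?thesis
      using that wd[of "SOME y. y \<in> carrier A \<and> I +> x = I +> y" x]
      by (auto simp: s_def quot_carrier)
  qed
  have "s \<in> calg_hom (quotient_algebra A I) B"
    by (rule calg_homI)
      (auto simp: quot_carrier quot_add quot_mult quot_sm quot_one s calg_homD[OF h])
  then show ?thesis using that s by (auto simp: s_def)
qed

end


subsection \<open>Monoid algebras\<close>

lemma keys_map_mult: "Poly_Mapping.keys (Poly_Mapping.map ((*) c) p) \<subseteq> Poly_Mapping.keys p"
  for c :: complex
  by (auto simp: in_keys_iff Poly_Mapping.map.rep_eq when_def split: if_splits)

lemma lookup_map_mult: "Poly_Mapping.lookup (Poly_Mapping.map ((*) c) p) a = c * Poly_Mapping.lookup p a"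
  for c :: complex
  by (auto simp: Poly_Mapping.map.rep_eq when_def)

lemma ma_simps [simp]:
  "carrier (monoid_algebra G) = {p. Poly_Mapping.keys p \<subseteq> carrier G}"
  "\<one>\<^bsub>monoid_algebra G\<^esub> = Poly_Mapping.single \<one>\<^bsub>G\<^esub> 1"
  "\<zero>\<^bsub>monoid_algebra G\<^esub> = 0"
  "p \<oplus>\<^bsub>monoid_algebra G\<^esub> r = p + r"
  "c \<odot>\<^bsub>monoid_algebra G\<^esub> p = Poly_Mapping.map ((*) c) p"
  by (simp_all add: monoid_algebra_def)

lemma ma_mult:
  assumes "finite S" "Poly_Mapping.keys p \<subseteq> S" "finite T" "Poly_Mapping.keys r \<subseteq> T"
  shows "p \<otimes>\<^bsub>monoid_algebra G\<^esub> r = (\<Sum>a\<in>S. \<Sum>b\<in>T.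
     Poly_Mapping.single (a \<otimes>\<^bsub>G\<^esub> b) (Poly_Mapping.lookup p a * Poly_Mapping.lookup r b))"
proof -
  have "(\<Sum>b\<in>Poly_Mapping.keys r.
     Poly_Mapping.single (a \<otimes>\<^bsub>G\<^esub> b) (Poly_Mapping.lookup p a * Poly_Mapping.lookup r b)) =
    (\<Sum>b\<in>T. Poly_Mapping.single (a \<otimes>\<^bsub>G\<^esub> b) (Poly_Mapping.lookup p a * Poly_Mapping.lookup r b))" for a
    using assms by (intro sum.mono_neutral_left) (auto simp: in_keys_iff)
  then have "p \<otimes>\<^bsub>monoid_algebra G\<^esub> r = (\<Sum>a\<in>Poly_Mapping.keys p. \<Sum>b\<in>T.
     Poly_Mapping.single (a \<otimes>\<^bsub>G\<^esub> b) (Poly_Mapping.lookup p a * Poly_Mapping.lookup r b))"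
    by (simp add: monoid_algebra_def)
  also have "\<dots> = (\<Sum>a\<in>S. \<Sum>b\<in>T.
     Poly_Mapping.single (a \<otimes>\<^bsub>G\<^esub> b) (Poly_Mapping.lookup p a * Poly_Mapping.lookup r b))"
    using assms by (intro sum.mono_neutral_left) (auto simp: in_keys_iff)
  finally show ?thesis .
qed

lemma ma_mult_ladd:
  "(p + p') \<otimes>\<^bsub>monoid_algebra G\<^esub> r = p \<otimes>\<^bsub>monoid_algebra G\<^esub> r + p' \<otimes>\<^bsub>monoid_algebra G\<^esub> r"
proof -
  let ?S = "Poly_Mapping.keys p \<union> Poly_Mapping.keys p'" and ?T = "Poly_Mapping.keys r"
  have k: "Poly_Mapping.keys (p + p') \<subseteq> ?S" by (rule Poly_Mapping.keys_add)
  show ?thesis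
    by (subst (1 2 3) ma_mult[of ?S _ ?T])
      (use k in \<open>auto simp: lookup_add algebra_simps single_add sum.distrib\<close>)
qed

lemma ma_mult_radd:
  "r \<otimes>\<^bsub>monoid_algebra G\<^esub> (p + p') = r \<otimes>\<^bsub>monoid_algebra G\<^esub> p + r \<otimes>\<^bsub>monoid_algebra G\<^esub> p'"
proof -
  let ?S = "Poly_Mapping.keys p \<union> Poly_Mapping.keys p'" and ?T = "Poly_Mapping.keys r"
  have k: "Poly_Mapping.keys (p + p') \<subseteq> ?S" by (rule Poly_Mapping.keys_add)
  show ?thesis
    by (subst (1 2 3) ma_mult[of ?T _ ?S])
      (use k in \<open>auto simp: lookup_add algebra_simps single_add sum.distrib\<close>)
qed

lemma ma_mult_single [simp]:
  "Poly_Mapping.single a c \<otimes>\<^bsub>monoid_algebra G\<^esub> Poly_Mapping.single b d =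
     Poly_Mapping.single (a \<otimes>\<^bsub>G\<^esub> b) (c * d)"
  by (subst ma_mult[of "{a}" _ "{b}"]) auto

lemma ma_induct [consumes 1, case_names zero single add]:
  fixes p :: "'a \<Rightarrow>\<^sub>0 complex"
  assumes "Poly_Mapping.keys p \<subseteq> carrier G"
    and z: "P 0"
    and s: "\<And>a c. a \<in> carrier G \<Longrightarrow> P (Poly_Mapping.single a c)"
    and a: "\<And>p r. \<lbrakk>Poly_Mapping.keys p \<subseteq> carrier G; Poly_Mapping.keys r \<subseteq> carrier G; P p; P r\<rbrakk>
      \<Longrightarrow> P (p + r)"
  shows "P p"
proof -
  have P: "P (\<Sum>a\<in>S. Poly_Mapping.single a (Poly_Mapping.lookup p a))
    \<and> Poly_Mapping.keys (\<Sum>a\<in>S. Poly_Mapping.single a (Poly_Mapping.lookup p a)) \<subseteq> carrier G"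
    if "finite S" "S \<subseteq> carrier G" for S
    using that
  proof (induction S rule: finite_induct)
    case empty
    then show ?case using z by simp
  next
    case (insert x S)
    let ?s = "Poly_Mapping.single x (Poly_Mapping.lookup p x)"
    let ?r = "\<Sum>a\<in>S. Poly_Mapping.single a (Poly_Mapping.lookup p a)"
    have x: "Poly_Mapping.keys ?s \<subseteq> carrier G" using insert by auto
    have IH: "P ?r" "Poly_Mapping.keys ?r \<subseteq> carrier G" using insert by auto
    have "P (?s + ?r)" by (rule a[OF x IH(2) s IH(1)]) (use insert in auto)
    moreover have "Poly_Mapping.keys (?s + ?r) \<subseteq> carrier G"
      by (rule order_trans[OF Poly_Mapping.keys_add]) (use x IH(2) in simp)
    ultimately show ?case using insert by simp
  qed
  have "(\<Sum>a\<in>Poly_Mapping.keys p. Poly_Mapping.single a (Poly_Mapping.lookup p a)) = p"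
    by (rule poly_mapping_eqI)
      (auto simp: lookup_sum lookup_single when_def in_keys_iff sum.delta)
  then show ?thesis using P[OF finite_keys assms(1)] by simp
qed

lemma ma_smult_single [simp]:
  "Poly_Mapping.map ((*) c) (Poly_Mapping.single a d) = Poly_Mapping.single a (c * d)" for c :: complex
  by (rule poly_mapping_eqI) (simp add: lookup_map_mult lookup_single when_def)

lemma ma_smult_add:
  "Poly_Mapping.map ((*) c) (p + r) = Poly_Mapping.map ((*) c) p + Poly_Mapping.map ((*) c) r" for c :: complex
  by (rule poly_mapping_eqI) (simp add: lookup_map_mult lookup_add algebra_simps)

lemma ma_smult_0 [simp]: "Poly_Mapping.map ((*) c) 0 = 0" for c :: complex
  by (rule poly_mapping_eqI) (simp add: lookup_map_mult)

lemma ma_smult_minus: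
  "Poly_Mapping.map ((*) c) (p - r) = Poly_Mapping.map ((*) c) p - Poly_Mapping.map ((*) c) r" for c :: complex
  by (rule poly_mapping_eqI) (simp add: lookup_map_mult lookup_minus algebra_simps)

lemma ma_mult_0 [simp]:
  "0 \<otimes>\<^bsub>monoid_algebra G\<^esub> p = 0" "p \<otimes>\<^bsub>monoid_algebra G\<^esub> 0 = 0"
  by (simp_all add: monoid_algebra_def)

lemma keys_plusI:
  "Poly_Mapping.keys p \<subseteq> S \<Longrightarrow> Poly_Mapping.keys r \<subseteq> S \<Longrightarrow> Poly_Mapping.keys (p + r) \<subseteq> S"
  by (rule order_trans[OF Poly_Mapping.keys_add]) simp

context
  fixes G :: "('a, 'm) monoid_scheme"
  assumes G: "monoid G"
begin

lemma ma_closed: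
  assumes "Poly_Mapping.keys p \<subseteq> carrier G" "Poly_Mapping.keys r \<subseteq> carrier G"
  shows "Poly_Mapping.keys (p \<otimes>\<^bsub>monoid_algebra G\<^esub> r) \<subseteq> carrier G"
  using assms(1)
proof (induction p rule: ma_induct)
  case (single a c)
  from assms(2) show ?case
  proof (induction r rule: ma_induct)
    case (single b d)
    then show ?case using \<open>a \<in> carrier G\<close> monoid.m_closed[OF G] by auto
  next
    case (add p r)
    then show ?case unfolding ma_mult_radd by (intro keys_plusI)
  qed simp
next
  case (add p r)
  then show ?case unfolding ma_mult_ladd by (intro keys_plusI)
qed simp

lemma ma_assoc:
  assumes "Poly_Mapping.keys p \<subseteq> carrier G" "Poly_Mapping.keys r \<subseteq> carrier G"
    "Poly_Mapping.keys s \<subseteq> carrier G"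
  shows "p \<otimes>\<^bsub>monoid_algebra G\<^esub> r \<otimes>\<^bsub>monoid_algebra G\<^esub> s
    = p \<otimes>\<^bsub>monoid_algebra G\<^esub> (r \<otimes>\<^bsub>monoid_algebra G\<^esub> s)"
  using assms(1)
proof (induction p rule: ma_induct)
  case p: (single a c)
  from assms(2) show ?case
  proof (induction r rule: ma_induct)
    case r: (single b d)
    from assms(3) show ?case
    proof (induction s rule: ma_induct)
      case (single e f)
      then show ?case using p r monoid.m_assoc[OF G] by (simp add: mult.assoc)
    qed (simp_all add: ma_mult_ladd ma_mult_radd)
  qed (simp_all add: ma_mult_ladd ma_mult_radd)
qed (simp_all add: ma_mult_ladd ma_mult_radd)

lemma ma_sm_ml:
  assumes "Poly_Mapping.keys p \<subseteq> carrier G" "Poly_Mapping.keys r \<subseteq> carrier G"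
  shows "Poly_Mapping.map ((*) c) p \<otimes>\<^bsub>monoid_algebra G\<^esub> r
    = Poly_Mapping.map ((*) c) (p \<otimes>\<^bsub>monoid_algebra G\<^esub> r)"
  using assms(1)
proof (induction p rule: ma_induct)
  case p: (single a d)
  from assms(2) show ?case
    by (induction r rule: ma_induct) (simp_all add: ma_mult_radd ma_smult_add mult.assoc)
qed (simp_all add: ma_mult_ladd ma_smult_add)

lemma ma_sm_mr:
  assumes "Poly_Mapping.keys p \<subseteq> carrier G" "Poly_Mapping.keys r \<subseteq> carrier G"
  shows "p \<otimes>\<^bsub>monoid_algebra G\<^esub> Poly_Mapping.map ((*) c) r
    = Poly_Mapping.map ((*) c) (p \<otimes>\<^bsub>monoid_algebra G\<^esub> r)"
  using assms(1)
proof (induction p rule: ma_induct)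
  case p: (single a d)
  from assms(2) show ?case
    by (induction r rule: ma_induct) (simp_all add: ma_mult_radd ma_smult_add mult.left_commute)
qed (simp_all add: ma_mult_ladd ma_smult_add)

lemma ma_one:
  assumes "Poly_Mapping.keys p \<subseteq> carrier G"
  shows "Poly_Mapping.single \<one>\<^bsub>G\<^esub> 1 \<otimes>\<^bsub>monoid_algebra G\<^esub> p = p"
    "p \<otimes>\<^bsub>monoid_algebra G\<^esub> Poly_Mapping.single \<one>\<^bsub>G\<^esub> 1 = p"
  using assms by (induction p rule: ma_induct)
    (simp_all add: ma_mult_ladd ma_mult_radd monoid.l_one[OF G] monoid.r_one[OF G])

lemma ma_ring: "ring (monoid_algebra G)"
proof (intro ringI abelian_groupI monoidI)
  show "\<exists>y\<in>carrier (monoid_algebra G). y \<oplus>\<^bsub>monoid_algebra G\<^esub> x = \<zero>\<^bsub>monoid_algebra G\<^esub>"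
    if "x \<in> carrier (monoid_algebra G)" for x
    using that by (intro bexI[of _ "- x"]) auto
qed (simp_all add: keys_plusI ma_closed ma_assoc ma_one ma_mult_ladd ma_mult_radd
       monoid.one_closed[OF G] add_ac)

lemma ma_calgebra: "calgebra (monoid_algebra G)"
proof (intro calgebra.intro ma_ring calgebra_axioms.intro)
  fix c :: complex and x
  show "x \<in> carrier (monoid_algebra G) \<Longrightarrow>
    c \<odot>\<^bsub>monoid_algebra G\<^esub> x \<in> carrier (monoid_algebra G)"
    using keys_map_mult[of c x] by auto
  show "1 \<odot>\<^bsub>monoid_algebra G\<^esub> x = x"
    by (auto intro!: poly_mapping_eqI simp: lookup_map_mult)
  show "(c + d) \<odot>\<^bsub>monoid_algebra G\<^esub> x = c \<odot>\<^bsub>monoid_algebra G\<^esub> x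
    \<oplus>\<^bsub>monoid_algebra G\<^esub> d \<odot>\<^bsub>monoid_algebra G\<^esub> x" for d
    by (auto intro!: poly_mapping_eqI simp: lookup_map_mult lookup_add algebra_simps)
  show "(c * d) \<odot>\<^bsub>monoid_algebra G\<^esub> x
    = c \<odot>\<^bsub>monoid_algebra G\<^esub> (d \<odot>\<^bsub>monoid_algebra G\<^esub> x)" for d
    by (auto intro!: poly_mapping_eqI simp: lookup_map_mult)
qed (simp_all add: ma_smult_add ma_sm_ml ma_sm_mr)

lemma ma_minus:
  assumes "Poly_Mapping.keys p \<subseteq> carrier G" "Poly_Mapping.keys r \<subseteq> carrier G"
  shows "p \<ominus>\<^bsub>monoid_algebra G\<^esub> r = p - r"
proof -
  interpret ring "monoid_algebra G" by (rule ma_ring)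
  have "\<ominus>\<^bsub>monoid_algebra G\<^esub> r = - r"
    by (rule minus_equality) (use assms in auto)
  then show ?thesis by (simp add: a_minus_def)
qed

lemma ma_hom_unique:
  assumes B: "calgebra B" and h: "h \<in> calg_hom (monoid_algebra G) B"
    and k: "k \<in> calg_hom (monoid_algebra G) B"
    and e: "\<And>a. a \<in> carrier G \<Longrightarrow> h (Poly_Mapping.single a 1) = k (Poly_Mapping.single a 1)"
    and p: "Poly_Mapping.keys p \<subseteq> carrier G"
  shows "h p = k p"
  using p
proof (induction p rule: ma_induct)
  case zero
  interpret h: ring_hom_ring "monoid_algebra G" B h by (rule calg_hom_ring[OF ma_calgebra B h])
  interpret k: ring_hom_ring "monoid_algebra G" B k by (rule calg_hom_ring[OF ma_calgebra B k])
  show ?case using h.hom_zero k.hom_zero by simp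
next
  case (single a c)
  then show ?case
    using calg_homD(5)[OF h, of "Poly_Mapping.single a 1" c]
      calg_homD(5)[OF k, of "Poly_Mapping.single a 1" c] e[of a] by simp
next
  case (add p r)
  then show ?case using calg_homD(3)[OF h, of p r] calg_homD(3)[OF k, of p r] by simp
qed

lemma ma_lift:
  assumes B: "calgebra B" and f: "f \<in> carrier G \<rightarrow> carrier B"
    and f1: "f \<one>\<^bsub>G\<^esub> = \<one>\<^bsub>B\<^esub>"
    and fm: "\<And>a b. \<lbrakk>a \<in> carrier G; b \<in> carrier G\<rbrakk> \<Longrightarrow> f (a \<otimes>\<^bsub>G\<^esub> b) = f a \<otimes>\<^bsub>B\<^esub> f b"
  obtains h where "h \<in> calg_hom (monoid_algebra G) B"
    "\<And>a c. a \<in> carrier G \<Longrightarrow> h (Poly_Mapping.single a c) = c \<odot>\<^bsub>B\<^esub> f a"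
proof -
  interpret B: calgebra B by (rule B)
  have fc: "a \<in> carrier G \<Longrightarrow> f a \<in> carrier B" for a using f by auto
  define h where "h p = finsum B (\<lambda>a. Poly_Mapping.lookup p a \<odot>\<^bsub>B\<^esub> f a) (Poly_Mapping.keys p)" for p
  have h_sup: "h p = finsum B (\<lambda>a. Poly_Mapping.lookup p a \<odot>\<^bsub>B\<^esub> f a) S"
    if "finite S" "Poly_Mapping.keys p \<subseteq> S" "S \<subseteq> carrier G" for p S
    unfolding h_def using that fc
    by (intro B.add.finprod_mono_neutral_cong_left) (auto simp: in_keys_iff Pi_def)
  have hs: "h (Poly_Mapping.single a c) = c \<odot>\<^bsub>B\<^esub> f a" if "a \<in> carrier G" for a c
    using that fc by (subst h_sup[of "{a}"]) (auto simp: Pi_def)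
  have h0: "h 0 = \<zero>\<^bsub>B\<^esub>" by (simp add: h_def)
  have hadd: "h (p + r) = h p \<oplus>\<^bsub>B\<^esub> h r"
    if "Poly_Mapping.keys p \<subseteq> carrier G" "Poly_Mapping.keys r \<subseteq> carrier G" for p r
  proof -
    let ?S = "Poly_Mapping.keys p \<union> Poly_Mapping.keys r"
    have S: "finite ?S" "?S \<subseteq> carrier G" using that by auto
    have "h (p + r) = finsum B (\<lambda>a. Poly_Mapping.lookup (p + r) a \<odot>\<^bsub>B\<^esub> f a) ?S"
      by (rule h_sup[OF S(1) _ S(2)]) (intro keys_plusI; simp)
    also have "\<dots> = finsum B (\<lambda>a. Poly_Mapping.lookup p a \<odot>\<^bsub>B\<^esub> f a
        \<oplus>\<^bsub>B\<^esub> Poly_Mapping.lookup r a \<odot>\<^bsub>B\<^esub> f a) ?S"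
      by (rule B.finsum_cong') (use S(2) fc in \<open>auto simp: lookup_add B.sm_ladd Pi_def subset_iff\<close>)
    also have "\<dots> = finsum B (\<lambda>a. Poly_Mapping.lookup p a \<odot>\<^bsub>B\<^esub> f a) ?S
        \<oplus>\<^bsub>B\<^esub> finsum B (\<lambda>a. Poly_Mapping.lookup r a \<odot>\<^bsub>B\<^esub> f a) ?S"
      by (rule B.finsum_addf) (use S(2) fc in \<open>auto simp: Pi_def subset_iff\<close>)
    also have "\<dots> = h p \<oplus>\<^bsub>B\<^esub> h r" using S h_sup[of ?S p] h_sup[of ?S r] by simp
    finally show ?thesis .
  qed
  have hc: "h p \<in> carrier B" if "Poly_Mapping.keys p \<subseteq> carrier G" for p
    using that by (induction p rule: ma_induct) (simp_all add: h0 hs hadd fc)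
  have hm: "h (p \<otimes>\<^bsub>monoid_algebra G\<^esub> r) = h p \<otimes>\<^bsub>B\<^esub> h r"
    if p: "Poly_Mapping.keys p \<subseteq> carrier G" and r: "Poly_Mapping.keys r \<subseteq> carrier G" for p r
    using p
  proof (induction p rule: ma_induct)
    case a: (single a c)
    from r show ?case
    proof (induction r rule: ma_induct)
      case (single b d)
      then show ?case using a
        by (simp add: hs fm fc B.sm_ml B.sm_mr monoid.m_closed[OF G] mult.commute flip: B.sm_assoc)
    next
      case (add p r)
      then show ?case using a
        by (simp add: ma_mult_radd hadd ma_closed B.r_distr hc)
    qed (use a in \<open>simp add: h0 hs fc\<close>)
  next
    case (add p p')
    then show ?case using r by (simp add: ma_mult_ladd hadd ma_closed B.l_distr hc)
  qed (use r in \<open>simp add: h0 hc\<close>)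
  have hsm: "h (Poly_Mapping.map ((*) c) p) = c \<odot>\<^bsub>B\<^esub> h p"
    if "Poly_Mapping.keys p \<subseteq> carrier G" for p c
    using that
  proof (induction p rule: ma_induct)
    case (add p r)
    then have "Poly_Mapping.keys (Poly_Mapping.map ((*) c) p) \<subseteq> carrier G"
      "Poly_Mapping.keys (Poly_Mapping.map ((*) c) r) \<subseteq> carrier G"
      by (auto intro!: order_trans[OF keys_map_mult])
    then show ?case using add by (simp add: ma_smult_add hadd B.sm_radd hc)
  qed (simp_all add: h0 hs fc B.sm_assoc)
  have "h \<in> calg_hom (monoid_algebra G) B"
    by (rule calg_homI) (simp_all add: hc hm hadd hsm hs f1 monoid.one_closed[OF G])
  then show ?thesis using hs that by blast
qed

end

lemma free_monoid: "monoid \<lparr>carrier = lists X, mult = (@), one = []\<rparr>"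
  by (rule monoidI) auto

lemma free_calgebra: "calgebra (free_algebra X)"
  unfolding free_algebra_def by (rule ma_calgebra[OF free_monoid])

subsection \<open>The tensor product\<close>

lemma ma_mult_diff:
  "r \<otimes>\<^bsub>monoid_algebra G\<^esub> (p - p') = r \<otimes>\<^bsub>monoid_algebra G\<^esub> p - r \<otimes>\<^bsub>monoid_algebra G\<^esub> p'"
  "(p - p') \<otimes>\<^bsub>monoid_algebra G\<^esub> r = p \<otimes>\<^bsub>monoid_algebra G\<^esub> r - p' \<otimes>\<^bsub>monoid_algebra G\<^esub> r"
  using ma_mult_radd[where p = "p - p'" and p' = p' and r = r and G = G]
    ma_mult_ladd[where p = "p - p'" and p' = p' and r = r and G = G] by simp_all

context
  fixes A :: "'a calg" and B :: "'b calg"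
  assumes A: "calgebra A" and B: "calgebra B"
begin

interpretation A: calgebra A by (rule A)
interpretation B: calgebra B by (rule B)

lemma tensor_monoid: "monoid (A \<times>\<times> B)"
  by (rule DirProd_monoid) (rule A.monoid_axioms B.monoid_axioms)+

interpretation M: calgebra "monoid_algebra (A \<times>\<times> B)" by (rule ma_calgebra[OF tensor_monoid])

lemma tensor_rels_carrier: "tensor_relations A B \<subseteq> carrier (monoid_algebra (A \<times>\<times> B))"
proof -
  have m: "p - r \<in> carrier (monoid_algebra (A \<times>\<times> B))"
    if "p \<in> carrier (monoid_algebra (A \<times>\<times> B))" "r \<in> carrier (monoid_algebra (A \<times>\<times> B))" for p r
    using that ma_minus[OF tensor_monoid, of p r] M.minus_closed[of p r] by simp
  show ?thesis
    unfolding tensor_relations_def by (auto intro!: m simp del: ma_simps(1)) simp_all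
qed

lemma tensor_relI:
  "\<lbrakk>a \<in> carrier A; a' \<in> carrier A; b \<in> carrier B\<rbrakk> \<Longrightarrow> Poly_Mapping.single (a \<oplus>\<^bsub>A\<^esub> a', b) 1
    - Poly_Mapping.single (a, b) 1 - Poly_Mapping.single (a', b) 1 \<in> tensor_relations A B"
  "\<lbrakk>a \<in> carrier A; b \<in> carrier B; b' \<in> carrier B\<rbrakk> \<Longrightarrow> Poly_Mapping.single (a, b \<oplus>\<^bsub>B\<^esub> b') 1
    - Poly_Mapping.single (a, b) 1 - Poly_Mapping.single (a, b') 1 \<in> tensor_relations A B"
  "\<lbrakk>a \<in> carrier A; b \<in> carrier B\<rbrakk> \<Longrightarrow> Poly_Mapping.single (c \<odot>\<^bsub>A\<^esub> a, b) 1
    - Poly_Mapping.single (a, b) c \<in> tensor_relations A B"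
  "\<lbrakk>a \<in> carrier A; b \<in> carrier B\<rbrakk> \<Longrightarrow> Poly_Mapping.single (a, c \<odot>\<^bsub>B\<^esub> b) 1
    - Poly_Mapping.single (a, b) c \<in> tensor_relations A B"
  unfolding tensor_relations_def by blast+

lemma tensor_rel_cases:
  assumes "r \<in> tensor_relations A B"
  obtains (1) a a' b where
      "r = Poly_Mapping.single (a \<oplus>\<^bsub>A\<^esub> a', b) 1 - Poly_Mapping.single (a, b) 1 - Poly_Mapping.single (a', b) 1"
      "a \<in> carrier A" "a' \<in> carrier A" "b \<in> carrier B"
    | (2) a b b' where
      "r = Poly_Mapping.single (a, b \<oplus>\<^bsub>B\<^esub> b') 1 - Poly_Mapping.single (a, b) 1 - Poly_Mapping.single (a, b') 1"
      "a \<in> carrier A" "b \<in> carrier B" "b' \<in> carrier B"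
    | (3) c a b where
      "r = Poly_Mapping.single (c \<odot>\<^bsub>A\<^esub> a, b) 1 - Poly_Mapping.single (a, b) c"
      "a \<in> carrier A" "b \<in> carrier B"
    | (4) c a b where
      "r = Poly_Mapping.single (a, c \<odot>\<^bsub>B\<^esub> b) 1 - Poly_Mapping.single (a, b) c"
      "a \<in> carrier A" "b \<in> carrier B"
  using assms unfolding tensor_relations_def
  apply (elim UnE CollectE exE conjE)
  subgoal by (rule that(1))
  subgoal by (rule that(2))
  subgoal by (rule that(3))
  subgoal by (rule that(4))
  done

lemma tensor_ideal_subspace:
  "additive_subgroup (tensor_ideal A B) (monoid_algebra (A \<times>\<times> B))"
  "p \<in> tensor_ideal A B \<Longrightarrow> Poly_Mapping.map ((*) c) p \<in> tensor_ideal A B"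
  "tensor_relations A B \<subseteq> tensor_ideal A B"
proof -
  let ?M = "monoid_algebra (A \<times>\<times> B)"
  let ?T = "{W. (additive_subgroup W ?M \<and> (\<forall>c. \<forall>p\<in>W. c \<odot>\<^bsub>?M\<^esub> p \<in> W)) \<and> tensor_relations A B \<subseteq> W}"
  have T: "tensor_ideal A B = \<Inter>?T" by (simp add: tensor_ideal_def hull_def)
  have "additive_subgroup (carrier ?M) ?M"
    by (rule additive_subgroupI) (use group.subgroup_self[OF M.a_group] in simp)
  then have "carrier ?M \<in> ?T"
    using tensor_rels_carrier M.sm_closed by (auto simp del: ma_simps)
  then have ne: "?T \<noteq> {}" by blast
  have "subgroup (\<Inter>?T) (add_monoid ?M)"
    by (rule group.subgroups_Inter[OF M.a_group _ ne])
      (auto simp: additive_subgroup_def)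
  then show "additive_subgroup (tensor_ideal A B) ?M"
    unfolding T by (rule additive_subgroupI)
  show "p \<in> tensor_ideal A B \<Longrightarrow> Poly_Mapping.map ((*) c) p \<in> tensor_ideal A B"
    "tensor_relations A B \<subseteq> tensor_ideal A B"
    unfolding T by auto
qed

lemma tensor_ideal_minimal:
  assumes "additive_subgroup W (monoid_algebra (A \<times>\<times> B))"
    "\<And>c p. p \<in> W \<Longrightarrow> Poly_Mapping.map ((*) c) p \<in> W" "tensor_relations A B \<subseteq> W"
  shows "tensor_ideal A B \<subseteq> W"
  unfolding tensor_ideal_def by (rule hull_minimal) (use assms in auto)

lemma tensor_ideal_diff:
  assumes "p \<in> tensor_ideal A B" "r \<in> tensor_ideal A B" shows "p + r \<in> tensor_ideal A B"
  using additive_subgroup.a_closed[OF tensor_ideal_subspace(1) assms] by simp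

lemma tensor_ideal_mult_single:
  assumes xy: "x \<in> carrier A" "y \<in> carrier B" and p: "p \<in> tensor_ideal A B"
  shows "Poly_Mapping.single (x, y) c \<otimes>\<^bsub>monoid_algebra (A \<times>\<times> B)\<^esub> p \<in> tensor_ideal A B"
    "p \<otimes>\<^bsub>monoid_algebra (A \<times>\<times> B)\<^esub> Poly_Mapping.single (x, y) c \<in> tensor_ideal A B"
proof -
  let ?M = "monoid_algebra (A \<times>\<times> B)" and ?T = "tensor_ideal A B"
  let ?s = "Poly_Mapping.single (x, y) c"
  define W where "W = {p \<in> carrier ?M. ?s \<otimes>\<^bsub>?M\<^esub> p \<in> ?T \<and> p \<otimes>\<^bsub>?M\<^esub> ?s \<in> ?T}"
  interpret T: additive_subgroup ?T ?M by (rule tensor_ideal_subspace(1))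
  have s: "?s \<in> carrier ?M" using xy by auto
  have "additive_subgroup W ?M"
  proof (rule additive_subgroupI, rule group.subgroupI[OF M.a_group])
    show "W \<subseteq> carrier (add_monoid ?M)" unfolding W_def by auto
    have "\<zero>\<^bsub>?M\<^esub> \<in> W" using T.zero_closed by (auto simp: W_def)
    then show "W \<noteq> {}" by blast
    fix a b assume a: "a \<in> W"
    have "\<ominus>\<^bsub>?M\<^esub> a \<in> W"
      using a s unfolding W_def
      by (simp add: M.r_minus M.l_minus T.a_inv_closed[simplified] del: ma_simps)
    then show "inv\<^bsub>add_monoid ?M\<^esub> a \<in> W" by (simp add: a_inv_def)
    assume b: "b \<in> W"
    have "a \<oplus>\<^bsub>?M\<^esub> b \<in> W"
      using a b s unfolding W_def
      by (simp add: M.r_distr M.l_distr T.a_closed del: ma_simps)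
    then show "a \<otimes>\<^bsub>add_monoid ?M\<^esub> b \<in> W" by simp
  qed
  moreover have "Poly_Mapping.map ((*) d) p \<in> W" if "p \<in> W" for d p
    using that s M.sm_closed[of p d] M.sm_mr[OF s, of p d] M.sm_ml[OF _ s, of p d]
      tensor_ideal_subspace(2)
    unfolding W_def by simp
  moreover have "r \<in> W" if r: "r \<in> tensor_relations A B" for r
  proof -
    have e: "?s = Poly_Mapping.map ((*) c) (Poly_Mapping.single (x, y) 1)" by simp
    have u: "Poly_Mapping.single (x, y) 1 \<in> carrier ?M" using xy by auto
    have rc: "r \<in> carrier ?M" using r tensor_rels_carrier by blast
    have "Poly_Mapping.single (x, y) 1 \<otimes>\<^bsub>?M\<^esub> r \<in> tensor_relations A B"
      using r
      by (cases rule: tensor_rel_cases)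
        (use xy in \<open>simp_all add: ma_mult_diff A.r_distr B.r_distr A.sm_mr B.sm_mr tensor_relI\<close>)
    moreover have "r \<otimes>\<^bsub>?M\<^esub> Poly_Mapping.single (x, y) 1 \<in> tensor_relations A B"
      using r
      by (cases rule: tensor_rel_cases)
        (use xy in \<open>simp_all add: ma_mult_diff A.l_distr B.l_distr A.sm_ml B.sm_ml tensor_relI\<close>)
    ultimately show ?thesis
      using tensor_ideal_subspace(2)[of _ c] tensor_ideal_subspace(3) rc
        M.sm_ml[OF u rc, of c] M.sm_mr[OF rc u, of c]
      unfolding W_def by auto
  qed
  ultimately have "?T \<subseteq> W" by (intro tensor_ideal_minimal) auto
  then show "?s \<otimes>\<^bsub>?M\<^esub> p \<in> ?T" "p \<otimes>\<^bsub>?M\<^esub> ?s \<in> ?T" using p by (auto simp: W_def)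
qed

lemma tensor_ideal_ideal: "ideal (tensor_ideal A B) (monoid_algebra (A \<times>\<times> B))"
proof (rule idealI)
  let ?M = "monoid_algebra (A \<times>\<times> B)" and ?T = "tensor_ideal A B"
  show "ring ?M" by (rule M.ring_axioms)
  show "subgroup ?T (add_monoid ?M)"
    using tensor_ideal_subspace(1) by (simp add: additive_subgroup_def)
  have z: "0 \<in> ?T" using additive_subgroup.zero_closed[OF tensor_ideal_subspace(1)] by simp
  fix a x assume a: "a \<in> ?T" and "x \<in> carrier ?M"
  then have x: "Poly_Mapping.keys x \<subseteq> carrier (A \<times>\<times> B)" by simp
  show "x \<otimes>\<^bsub>?M\<^esub> a \<in> ?T" using x
    by (induction x rule: ma_induct)
      (use a in \<open>auto simp: z ma_mult_ladd intro!: tensor_ideal_diff tensor_ideal_mult_single\<close>)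
  show "a \<otimes>\<^bsub>?M\<^esub> x \<in> ?T" using x
    by (induction x rule: ma_induct)
      (use a in \<open>auto simp: z ma_mult_radd intro!: tensor_ideal_diff tensor_ideal_mult_single\<close>)
qed

lemma tensor_calgebra: "calgebra (tensor_algebra A B)"
  unfolding tensor_algebra_def by (rule quot_calgebra[OF M.calgebra_axioms tensor_ideal_ideal])

lemma pure_tensor_closed:
  "\<lbrakk>a \<in> carrier A; b \<in> carrier B\<rbrakk> \<Longrightarrow> pure_tensor A B a b \<in> carrier (tensor_algebra A B)"
  unfolding tensor_algebra_def pure_tensor_def
    quot_carrier[OF M.calgebra_axioms tensor_ideal_ideal] by (rule imageI) auto

lemma pure_tensor_mult:
  assumes "a \<in> carrier A" "b \<in> carrier B" "a' \<in> carrier A" "b' \<in> carrier B"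
  shows "pure_tensor A B a b \<otimes>\<^bsub>tensor_algebra A B\<^esub> pure_tensor A B a' b'
    = pure_tensor A B (a \<otimes>\<^bsub>A\<^esub> a') (b \<otimes>\<^bsub>B\<^esub> b')"
  unfolding tensor_algebra_def pure_tensor_def
  by (subst quot_mult[OF M.calgebra_axioms tensor_ideal_ideal]) (use assms in auto)

lemma pure_tensor_sm:
  assumes "a \<in> carrier A" "b \<in> carrier B"
  shows "pure_tensor A B (c \<odot>\<^bsub>A\<^esub> a) b = c \<odot>\<^bsub>tensor_algebra A B\<^esub> pure_tensor A B a b"
    "pure_tensor A B a (c \<odot>\<^bsub>B\<^esub> b) = c \<odot>\<^bsub>tensor_algebra A B\<^esub> pure_tensor A B a b"
proof -
  let ?M = "monoid_algebra (A \<times>\<times> B)" and ?T = "tensor_ideal A B"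
  have s: "c \<odot>\<^bsub>tensor_algebra A B\<^esub> pure_tensor A B a b = ?T +>\<^bsub>?M\<^esub> Poly_Mapping.single (a, b) c"
    unfolding tensor_algebra_def pure_tensor_def
    by (subst quot_sm[OF M.calgebra_axioms tensor_ideal_ideal]) (use assms in auto)
  have e: "?T +>\<^bsub>?M\<^esub> p = ?T +>\<^bsub>?M\<^esub> r"
    if "p - r \<in> tensor_relations A B" "p \<in> carrier ?M" "r \<in> carrier ?M" for p r
    using that tensor_ideal_subspace(3) ma_minus[OF tensor_monoid, of p r]
    by (auto simp: quot_eq_iff[OF M.calgebra_axioms tensor_ideal_ideal])
  show "pure_tensor A B (c \<odot>\<^bsub>A\<^esub> a) b = c \<odot>\<^bsub>tensor_algebra A B\<^esub> pure_tensor A B a b"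
    unfolding s unfolding pure_tensor_def
    by (rule e) (use assms in \<open>auto simp: tensor_relations_def\<close>)
  show "pure_tensor A B a (c \<odot>\<^bsub>B\<^esub> b) = c \<odot>\<^bsub>tensor_algebra A B\<^esub> pure_tensor A B a b"
    unfolding s unfolding pure_tensor_def
    by (rule e) (use assms in \<open>auto simp: tensor_relations_def\<close>)
qed

end

subsection \<open>Quantum spaces\<close>

lemma free_simps [simp]:
  "carrier (free_algebra X) = {p. Poly_Mapping.keys p \<subseteq> lists X}"
  "\<one>\<^bsub>free_algebra X\<^esub> = Poly_Mapping.single [] 1"
  "\<zero>\<^bsub>free_algebra X\<^esub> = 0"
  "p \<oplus>\<^bsub>free_algebra X\<^esub> r = p + r"
  "c \<odot>\<^bsub>free_algebra X\<^esub> p = Poly_Mapping.map ((*) c) p"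
  "Poly_Mapping.single u c \<otimes>\<^bsub>free_algebra X\<^esub> Poly_Mapping.single v d = Poly_Mapping.single (u @ v) (c * d)"
  by (simp_all add: free_algebra_def)

lemma free_minus:
  assumes "p \<in> carrier (free_algebra X)" "r \<in> carrier (free_algebra X)"
  shows "p \<ominus>\<^bsub>free_algebra X\<^esub> r = p - r"
  using assms ma_minus[OF free_monoid, of p X r] by (simp add: free_algebra_def)

lemma quantum_rels_carrier:
  "{Poly_Mapping.single [j, i] 1 - Poly_Mapping.single [i, j] (q j i)
     | i j. i \<in> X \<and> j \<in> X \<and> i < j} \<subseteq> carrier (free_algebra (X :: 'x::linorder set))"
proof -
  interpret calgebra "free_algebra X" by (rule free_calgebra)
  have m: "p - r \<in> carrier (free_algebra X)"
    if "p \<in> carrier (free_algebra X)" "r \<in> carrier (free_algebra X)" for p r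
    using minus_closed[OF that] unfolding free_minus[OF that] .
  show ?thesis by (auto intro!: m simp del: free_simps) simp_all
qed

lemma quantum_ideal_ideal: "ideal (quantum_ideal X q) (free_algebra X)"
  unfolding quantum_ideal_def
  by (rule ring.genideal_ideal[OF calgebra.axioms(1)[OF free_calgebra] quantum_rels_carrier])

lemma quantum_calgebra: "calgebra (quantum_space X q)"
  unfolding quantum_space_def by (rule quot_calgebra[OF free_calgebra quantum_ideal_ideal])

lemma quantum_gen_closed: "x \<in> X \<Longrightarrow> quantum_gen X q x \<in> carrier (quantum_space X q)"
  unfolding quantum_space_def quantum_gen_def quot_carrier[OF free_calgebra quantum_ideal_ideal]
  by (rule imageI) auto

lemma quantum_gen_rel:
  assumes "i \<in> X" "j \<in> X" "i < j"
  shows "quantum_gen X q j \<otimes>\<^bsub>quantum_space X q\<^esub> quantum_gen X q i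
    = q j i \<odot>\<^bsub>quantum_space X q\<^esub> (quantum_gen X q i \<otimes>\<^bsub>quantum_space X q\<^esub> quantum_gen X q j)"
proof -
  note qi = free_calgebra[of X] quantum_ideal_ideal[of X q]
  let ?F = "free_algebra X"
  have s: "Poly_Mapping.single w c \<in> carrier ?F" if "w \<in> lists X" for w and c :: complex
    using that by auto
  have "Poly_Mapping.single [j, i] 1 - Poly_Mapping.single [i, j] (q j i) \<in> quantum_ideal X q"
    unfolding quantum_ideal_def
    by (rule subsetD[OF ring.genideal_self[OF calgebra.axioms(1)[OF free_calgebra] quantum_rels_carrier]])
      (use assms in blast)
  moreover have c: "Poly_Mapping.single [j, i] 1 \<in> carrier ?F"
      "Poly_Mapping.single [i, j] (q j i) \<in> carrier ?F"
    by (rule s, use assms in simp)+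
  ultimately have e: "quantum_ideal X q +>\<^bsub>?F\<^esub> Poly_Mapping.single [j, i] 1
     = quantum_ideal X q +>\<^bsub>?F\<^esub> Poly_Mapping.single [i, j] (q j i)"
    using quot_eq_iff[OF qi c] free_minus[OF c] by simp
  have "Poly_Mapping.single [i, j] (q j i) = q j i \<odot>\<^bsub>?F\<^esub>
    (Poly_Mapping.single [i] 1 \<otimes>\<^bsub>?F\<^esub> Poly_Mapping.single [j] 1)" by simp
  then show ?thesis
    using e s[of "[i]" 1] s[of "[j]" 1] s[of "[i, j]" 1] assms(1,2)
    unfolding quantum_space_def quantum_gen_def
    by (simp add: quot_mult[OF qi] quot_sm[OF qi])
qed

lemma quantum_lift:
  fixes X :: "'x::linorder set"
  assumes B: "calgebra B" and t: "\<And>x. x \<in> X \<Longrightarrow> t x \<in> carrier B"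
    and rel: "\<And>i j. \<lbrakk>i \<in> X; j \<in> X; i < j\<rbrakk> \<Longrightarrow>
      t j \<otimes>\<^bsub>B\<^esub> t i = q j i \<odot>\<^bsub>B\<^esub> (t i \<otimes>\<^bsub>B\<^esub> t j)"
  shows "\<exists>!s. s \<in> calg_hom (quantum_space X q) B \<and> s \<in> extensional (carrier (quantum_space X q)) \<and>
    (\<forall>x\<in>X. s (quantum_gen X q x) = t x)"
proof -
  interpret B: calgebra B by (rule B)
  note qi = free_calgebra[of X] quantum_ideal_ideal[of X q]
  let ?F = "free_algebra X"
  define f where "f w = foldr (\<lambda>x y. t x \<otimes>\<^bsub>B\<^esub> y) w \<one>\<^bsub>B\<^esub>" for w
  have fc: "w \<in> lists X \<Longrightarrow> f w \<in> carrier B" for w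
    by (induction w) (auto simp: f_def t)
  have fm: "u \<in> lists X \<Longrightarrow> v \<in> lists X \<Longrightarrow> f (u @ v) = f u \<otimes>\<^bsub>B\<^esub> f v" for u v
  proof (induction u)
    case Nil
    then show ?case using fc[of v] by (simp add: f_def)
  next
    case (Cons x u)
    then have "f (u @ v) = f u \<otimes>\<^bsub>B\<^esub> f v" "f u \<in> carrier B" "f v \<in> carrier B" "t x \<in> carrier B"
      using fc t by auto
    then show ?case by (simp add: f_def B.m_assoc)
  qed
  obtain h where h: "h \<in> calg_hom ?F B"
    and hs: "\<And>w c. w \<in> lists X \<Longrightarrow> h (Poly_Mapping.single w c) = c \<odot>\<^bsub>B\<^esub> f w"
    unfolding free_algebra_def
    by (rule ma_lift[OF free_monoid B, of f X]) (use fc fm in \<open>auto simp: f_def\<close>)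
  interpret h: ring_hom_ring ?F B h by (rule calg_hom_ring[OF free_calgebra B h])
  have "quantum_ideal X q \<subseteq> a_kernel ?F B h"
    unfolding quantum_ideal_def
  proof (rule h.R.genideal_minimal[OF h.kernel_is_ideal], safe)
    fix i j assume ij: "i \<in> X" "j \<in> X" "i < j"
    let ?u = "Poly_Mapping.single [j, i] 1" and ?v = "Poly_Mapping.single [i, j] (q j i)"
    have uv: "?u \<in> carrier ?F" "?v \<in> carrier ?F" "?u - ?v \<in> carrier ?F"
      using ij subsetD[OF quantum_rels_carrier[of q X], of "?u - ?v"] by auto
    have "h ((?u - ?v) \<oplus>\<^bsub>?F\<^esub> ?v) = h (?u - ?v) \<oplus>\<^bsub>B\<^esub> h ?v"
      by (rule h.hom_add[OF uv(3,2)])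
    moreover have "h ?u = h ?v"
      using ij rel[OF ij] t by (simp add: hs f_def)
    ultimately have "h ?v = h (?u - ?v) \<oplus>\<^bsub>B\<^esub> h ?v" by simp
    moreover have "h ?v \<in> carrier B" "h (?u - ?v) \<in> carrier B"
      by (rule h.hom_closed[OF uv(2)], rule h.hom_closed[OF uv(3)])
    ultimately have "h (?u - ?v) = \<zero>\<^bsub>B\<^esub>" by (metis B.add.r_cancel_one')
    then show "?u - ?v \<in> a_kernel ?F B h" using uv(3) unfolding a_kernel_def' by blast
  qed
  from quot_lift[OF qi B h this] obtain s where s: "s \<in> calg_hom (quantum_space X q) B"
    "s \<in> extensional (carrier (quantum_space X q))"
    "\<And>x. x \<in> carrier ?F \<Longrightarrow> s (quantum_ideal X q +>\<^bsub>?F\<^esub> x) = h x"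
    unfolding quantum_space_def by blast
  have sg: "\<forall>x\<in>X. s (quantum_gen X q x) = t x"
    unfolding quantum_gen_def by (simp add: s(3) hs f_def t)
  show ?thesis
  proof (rule ex1I[of _ s], use s sg in blast)
    fix k assume k: "k \<in> calg_hom (quantum_space X q) B \<and>
      k \<in> extensional (carrier (quantum_space X q)) \<and> (\<forall>x\<in>X. k (quantum_gen X q x) = t x)"
    let ?p = "\<lambda>x. quantum_ideal X q +>\<^bsub>?F\<^esub> x"
    have pr: "?p \<in> calg_hom ?F (quantum_space X q)"
      unfolding quantum_space_def by (rule quot_proj[OF qi])
    have hom: "k \<circ> ?p \<in> calg_hom ?F B" "s \<circ> ?p \<in> calg_hom ?F B"
      using calg_hom_comp[OF pr] k s(1) by blast+
    have w: "(k \<circ> ?p) (Poly_Mapping.single w 1) = (s \<circ> ?p) (Poly_Mapping.single w 1)"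
      if "w \<in> lists X" for w
      using that
    proof (induction w)
      case Nil
      then show ?case using calg_homD(4)[OF hom(1)] calg_homD(4)[OF hom(2)] by simp
    next
      case (Cons x w)
      have e: "Poly_Mapping.single (x # w) 1
        = Poly_Mapping.single [x] 1 \<otimes>\<^bsub>?F\<^esub> Poly_Mapping.single w (1 :: complex)" by simp
      have c: "Poly_Mapping.single [x] (1 :: complex) \<in> carrier ?F"
        "Poly_Mapping.single w (1 :: complex) \<in> carrier ?F" using Cons by auto
      have "(k \<circ> ?p) (Poly_Mapping.single [x] 1) = (s \<circ> ?p) (Poly_Mapping.single [x] 1)"
        using k sg Cons(1) unfolding quantum_gen_def by simp
      then show ?case
        unfolding e calg_homD(2)[OF hom(1) c] calg_homD(2)[OF hom(2) c] using Cons by simp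
    qed
    have "k (?p y) = s (?p y)" if "Poly_Mapping.keys y \<subseteq> lists X" for y
      using ma_hom_unique[OF free_monoid B, folded free_algebra_def, OF hom] w that by simp
    then show "k = s"
      using k s(2) by (intro extensionalityI[of k "carrier (quantum_space X q)" s])
        (auto simp: quantum_space_def quot_carrier[OF qi])
  qed
qed

lemma quantum_gen_rel':
  assumes q: "mult_antisym n q" and "i \<le> n" "j \<le> n"
  shows "quantum_gen {..n} q j \<otimes>\<^bsub>quantum_space {..n} q\<^esub> quantum_gen {..n} q i
    = q j i \<odot>\<^bsub>quantum_space {..n} q\<^esub>
      (quantum_gen {..n} q i \<otimes>\<^bsub>quantum_space {..n} q\<^esub> quantum_gen {..n} q j)"
proof -
  interpret Q: calgebra "quantum_space {..n} q" by (rule quantum_calgebra)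
  have c: "quantum_gen {..n} q i \<in> carrier (quantum_space {..n} q)"
    "quantum_gen {..n} q j \<in> carrier (quantum_space {..n} q)"
    using assms by (auto intro: quantum_gen_closed)
  consider "i < j" | "i = j" | "j < i" by linarith
  then show ?thesis
  proof cases
    case 1
    then show ?thesis using quantum_gen_rel[of i "{..n}" j q] assms by simp
  next
    case 2
    moreover have "q j j = 1" using q \<open>j \<le> n\<close> unfolding mult_antisym_def by blast
    ultimately show ?thesis using c by simp
  next
    case 3
    have "q i j \<noteq> 0" "q j i = inverse (q i j)" using assms unfolding mult_antisym_def by blast+
    then have "q j i * q i j = 1" by simp
    then show ?thesis
      using quantum_gen_rel[of j "{..n}" i q] assms 3 c
        Q.sm_assoc[of "quantum_gen {..n} q j \<otimes>\<^bsub>quantum_space {..n} q\<^esub> quantum_gen {..n} q i" "q j i" "q i j"]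
      by simp
  qed
qed


lemma segre_map_unique:
  assumes q: "mult_antisym n q" and q': "mult_antisym m q'"
  shows "\<exists>!s. is_segre_map n m q q' s"
proof -
  let ?A = "quantum_space {..n} q" and ?B = "quantum_space {..m} q'"
  let ?x = "quantum_gen {..n} q" and ?y = "quantum_gen {..m} q'"
  let ?T = "tensor_algebra ?A ?B"
  note A = quantum_calgebra[of "{..n}" q] and B = quantum_calgebra[of "{..m}" q']
  interpret A: calgebra ?A by (rule A)
  interpret B: calgebra ?B by (rule B)
  interpret T: calgebra ?T by (rule tensor_calgebra[OF A B])
  define t where "t = (\<lambda>(i, \<alpha>). pure_tensor ?A ?B (?x i) (?y \<alpha>))"
  have x: "i \<le> n \<Longrightarrow> ?x i \<in> carrier ?A" and y: "\<alpha> \<le> m \<Longrightarrow> ?y \<alpha> \<in> carrier ?B" for i \<alpha>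
    by (auto intro: quantum_gen_closed)
  have t: "z \<in> segre_index n m \<Longrightarrow> t z \<in> carrier ?T" for z
    using pure_tensor_closed[OF A B x y] by (auto simp: t_def segre_index_def)
  have rel: "t w \<otimes>\<^bsub>?T\<^esub> t z = segre_matrix q q' w z \<odot>\<^bsub>?T\<^esub> (t z \<otimes>\<^bsub>?T\<^esub> t w)"
    if "z \<in> segre_index n m" "w \<in> segre_index n m" for z w
  proof -
    obtain i \<alpha> j \<beta> where [simp]: "z = (i, \<alpha>)" "w = (j, \<beta>)" by (cases z, cases w)
    have l: "i \<le> n" "j \<le> n" "\<alpha> \<le> m" "\<beta> \<le> m" using that by (auto simp: segre_index_def)
    have c: "?x i \<otimes>\<^bsub>?A\<^esub> ?x j \<in> carrier ?A" "?y \<alpha> \<otimes>\<^bsub>?B\<^esub> ?y \<beta> \<in> carrier ?B"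
      using l x y by auto
    have "t w \<otimes>\<^bsub>?T\<^esub> t z = pure_tensor ?A ?B (?x j \<otimes>\<^bsub>?A\<^esub> ?x i) (?y \<beta> \<otimes>\<^bsub>?B\<^esub> ?y \<alpha>)"
      using l x y by (simp add: t_def pure_tensor_mult[OF A B])
    also have "\<dots> = pure_tensor ?A ?B (q j i \<odot>\<^bsub>?A\<^esub> (?x i \<otimes>\<^bsub>?A\<^esub> ?x j))
        (q' \<beta> \<alpha> \<odot>\<^bsub>?B\<^esub> (?y \<alpha> \<otimes>\<^bsub>?B\<^esub> ?y \<beta>))"
      using quantum_gen_rel'[OF q l(1,2)] quantum_gen_rel'[OF q' l(3,4)] by simp
    also have "\<dots> = q j i \<odot>\<^bsub>?T\<^esub> (q' \<beta> \<alpha> \<odot>\<^bsub>?T\<^esub> pure_tensor ?A ?B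
        (?x i \<otimes>\<^bsub>?A\<^esub> ?x j) (?y \<alpha> \<otimes>\<^bsub>?B\<^esub> ?y \<beta>))"
      by (simp only: pure_tensor_sm(1)[OF A B c(1) B.sm_closed[OF c(2)]] pure_tensor_sm(2)[OF A B c])
    also have "\<dots> = (q j i * q' \<beta> \<alpha>) \<odot>\<^bsub>?T\<^esub> (t z \<otimes>\<^bsub>?T\<^esub> t w)"
      using l x y c by (simp add: t_def pure_tensor_mult[OF A B] T.sm_assoc pure_tensor_closed[OF A B])
    finally show ?thesis by (simp add: segre_matrix_def)
  qed
  have e: "is_segre_map n m q q' s \<longleftrightarrow>
     s \<in> calg_hom (segre_source n m q q') ?T \<and> s \<in> extensional (carrier (segre_source n m q q')) \<and>
     (\<forall>z\<in>segre_index n m. s (quantum_gen (segre_index n m) (segre_matrix q q') z) = t z)" for s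
    by (auto simp: is_segre_map_def t_def segre_index_def)
  show ?thesis unfolding e
    by (rule quantum_lift[OF T.calgebra_axioms t rel])
qed

end

(*
Moving the letters of a word w into increasing order multiplies it by the product of q x y over the
inversions (x, y) of w.  The resulting linear map on the free algebra vanishes exactly on the defining
ideal of the quantum space, so it computes ordered forms, and products of coefficients of ordered forms
give linear functionals on the tensor product.  The image of an ordered monomial z_{i_1 a_1} ... z_{i_d a_d}
under the Segre map is determined, up to a nonzero scalar, by the multisets of its rows i_k and of its
columns a_k.  A monomial without an inversion between rows and columns is the smallest one with its two
multisets, so it cannot be the leading monomial of an element of the kernel: every other term of that
element with the same image would be larger.  A monomial with such an inversion is divisible by the
leading monomial of one of the quadratic relations.
*)
theory Submission
  imports Defs "HOL-Library.Multiset"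
begin

section \<open>Ordered forms in quantum spaces\<close>

definition linear_form :: "('a \<Rightarrow> complex) \<Rightarrow> ('a \<Rightarrow>\<^sub>0 complex) \<Rightarrow> complex" where
  "linear_form f p = (\<Sum>a\<in>Poly_Mapping.keys p. Poly_Mapping.lookup p a * f a)"

text \<open>The supports of \<open>p\<close>, \<open>r\<close> and \<open>p + r\<close> differ;
  summing over one common finite set turns additivity into a termwise computation.\<close>

lemma linear_form_superset:
  assumes "finite S" "Poly_Mapping.keys p \<subseteq> S"
  shows "linear_form f p = (\<Sum>a\<in>S. Poly_Mapping.lookup p a * f a)"
  unfolding linear_form_def using assms
  by (intro sum.mono_neutral_left) (auto simp: in_keys_iff)

lemma linear_form_add: "linear_form f (p + r) = linear_form f p + linear_form f r"
proof -
  let ?S = "Poly_Mapping.keys p \<union> Poly_Mapping.keys r"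
  have "Poly_Mapping.keys (p + r) \<subseteq> ?S" by (rule Poly_Mapping.keys_add)
  then show ?thesis
    by (subst (1 2 3) linear_form_superset[of ?S])
      (auto simp: lookup_add algebra_simps sum.distrib)
qed

lemma linear_form_smult: "linear_form f (Poly_Mapping.map ((*) c) p) = c * linear_form f p"
  by (subst linear_form_superset[of "Poly_Mapping.keys p"])
    (simp_all add: keys_map_mult linear_form_def lookup_map_mult sum_distrib_left mult.assoc)

lemma linear_form_single [simp]: "linear_form f (Poly_Mapping.single a c) = c * f a"
  by (subst linear_form_superset[of "{a}"]) auto

lemma linear_form_zero [simp]: "linear_form f 0 = 0"
  by (simp add: linear_form_def)

lemma linear_form_diff: "linear_form f (p - r) = linear_form f p - linear_form f r"
  using linear_form_add[of f "p - r" r] by simp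

text \<open>The scalar relating a word to its sorted version in the quantum space
  (\<open>quantum_class_sort\<close>): for \<open>y < x\<close> the defining relation replaces
  \<open>x y\<close> by \<open>q x y\<close> times \<open>y x\<close>, and sorting removes every
  inversion once. Equal letters cost nothing.\<close>

primrec reorder_coeff :: "('x::linorder \<Rightarrow> 'x \<Rightarrow> complex) \<Rightarrow> 'x list \<Rightarrow> complex" where
  "reorder_coeff q [] = 1"
| "reorder_coeff q (x # w) = (\<Prod>y\<leftarrow>w. if y < x then q x y else 1) * reorder_coeff q w"

lemma prod_list_map_cong_mset:
  "mset u = mset v \<Longrightarrow> (\<Prod>x\<leftarrow>u. f x) = (\<Prod>x\<leftarrow>v. f x :: complex)"
  by (metis mset_map prod_mset_prod_list)

lemma reorder_coeff_append:
  "reorder_coeff q (u @ v) =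
     reorder_coeff q u * reorder_coeff q v * (\<Prod>x\<leftarrow>u. \<Prod>y\<leftarrow>v. if y < x then q x y else 1)"
  by (induction u) simp_all

lemma reorder_coeff_sorted: "sorted w \<Longrightarrow> reorder_coeff q w = 1"
proof (induction w)
  case (Cons x w)
  then have "map (\<lambda>y. if y < x then q x y else 1) w = map (\<lambda>_. 1) w" by auto
  then show ?case using Cons by (simp add: map_replicate_const)
qed simp

text \<open>The factors coming from a letter of \<open>u\<close> and a letter of \<open>v\<close>
  depend only on the two multisets of letters, and the sorted words have no inversions of their own.
  This cocycle-like identity is what makes sorting compatible with multiplication.\<close>

lemma reorder_coeff_append_sort:
  "reorder_coeff q (u @ v) =
     reorder_coeff q u * reorder_coeff q v * reorder_coeff q (sort u @ sort v)"
proof -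
  have "(\<Prod>x\<leftarrow>u. \<Prod>y\<leftarrow>v. if y < x then q x y else 1) =
      (\<Prod>x\<leftarrow>sort u. \<Prod>y\<leftarrow>v. if y < x then q x y else 1)"
    by (rule prod_list_map_cong_mset) simp
  also have "\<dots> = (\<Prod>x\<leftarrow>sort u. \<Prod>y\<leftarrow>sort v. if y < x then q x y else 1)"
    by (subst prod_list_map_cong_mset[of v "sort v"]) simp_all
  finally show ?thesis by (simp add: reorder_coeff_append reorder_coeff_sorted)
qed

section \<open>The sorting map of the free algebra\<close>

definition reorder :: "('x::linorder \<Rightarrow> 'x \<Rightarrow> complex) \<Rightarrow> ('x list \<Rightarrow>\<^sub>0 complex) \<Rightarrow> ('x list \<Rightarrow>\<^sub>0 complex)" where
  "reorder q p = (\<Sum>w\<in>Poly_Mapping.keys p.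
     Poly_Mapping.single (sort w) (Poly_Mapping.lookup p w * reorder_coeff q w))"

text \<open>Every coefficient of the sorted element is a linear functional of \<open>p\<close>, so
  linearity of \<open>reorder\<close> is inherited from \<open>linear_form\<close>.\<close>

lemma lookup_reorder:
  "Poly_Mapping.lookup (reorder q p) v = linear_form (\<lambda>w. if sort w = v then reorder_coeff q w else 0) p"
  unfolding reorder_def linear_form_def lookup_sum
  by (rule sum.cong) (auto simp: lookup_single when_def)

lemma reorder_add: "reorder q (p + r) = reorder q p + reorder q r"
  by (rule poly_mapping_eqI) (simp add: lookup_reorder lookup_add linear_form_add)

lemma reorder_diff: "reorder q (p - r) = reorder q p - reorder q r"
  by (rule poly_mapping_eqI) (simp add: lookup_reorder lookup_minus linear_form_diff)

lemma reorder_smult: "reorder q (Poly_Mapping.map ((*) c) p) = Poly_Mapping.map ((*) c) (reorder q p)"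
  by (rule poly_mapping_eqI) (simp add: lookup_reorder lookup_map_mult linear_form_smult)

lemma reorder_single [simp]:
  "reorder q (Poly_Mapping.single w c) = Poly_Mapping.single (sort w) (c * reorder_coeff q w)"
  by (rule poly_mapping_eqI) (simp add: lookup_reorder lookup_single when_def)

lemma reorder_zero [simp]: "reorder q 0 = 0"
  by (simp add: reorder_def)

lemma free_induct [consumes 1, case_names zero single add]:
  fixes p :: "'x list \<Rightarrow>\<^sub>0 complex"
  assumes "p \<in> carrier (free_algebra X)" "P 0"
    "\<And>w c. w \<in> lists X \<Longrightarrow> P (Poly_Mapping.single w c)"
    "\<And>p r. \<lbrakk>p \<in> carrier (free_algebra X); r \<in> carrier (free_algebra X); P p; P r\<rbrakk> \<Longrightarrow> P (p + r)"
  shows "P p"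
  using ma_induct[of p "\<lparr>carrier = lists X, monoid.mult = (@), one = []\<rparr>" P] assms by simp

lemma reorder_keys:
  assumes "p \<in> carrier (free_algebra X)"
  shows "Poly_Mapping.keys (reorder q p) \<subseteq> ordered_monomials X"
  using assms
proof (induction p rule: free_induct)
  case (single w c)
  then show ?case by (auto simp: ordered_monomials_def in_lists_conv_set)
next
  case (add p r)
  then show ?case by (simp add: reorder_add keys_plusI)
qed simp

lemma ordered_monomials_lists: "ordered_monomials X \<subseteq> lists X"
  by (auto simp: ordered_monomials_def)

lemma reorder_closed: "p \<in> carrier (free_algebra X) \<Longrightarrow> reorder q p \<in> carrier (free_algebra X)"
  using reorder_keys[of p X q] ordered_monomials_lists[of X] by auto

text \<open>Sorted words are fixed with coefficient 1. Together with \<open>reorder_keys\<close>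
  this makes \<open>reorder q\<close> a projection of the free algebra onto the span of the ordered
  monomials.\<close>

lemma reorder_ordered:
  assumes "Poly_Mapping.keys p \<subseteq> ordered_monomials X"
  shows "reorder q p = p"
proof (rule poly_mapping_eqI)
  fix v
  have "Poly_Mapping.lookup (reorder q p) v = linear_form (\<lambda>w. if w = v then 1 else 0) p"
    unfolding lookup_reorder linear_form_def
    by (rule sum.cong)
      (use assms in \<open>auto simp: ordered_monomials_def sorted_sort_id reorder_coeff_sorted\<close>)
  also have "\<dots> = Poly_Mapping.lookup p v"
    by (simp add: linear_form_def in_keys_iff if_distrib cong: if_cong)
  finally show "Poly_Mapping.lookup (reorder q p) v = Poly_Mapping.lookup p v" .
qed

lemma free_distrib:
  "(p + p') \<otimes>\<^bsub>free_algebra X\<^esub> r = p \<otimes>\<^bsub>free_algebra X\<^esub> r + p' \<otimes>\<^bsub>free_algebra X\<^esub> r"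
  "r \<otimes>\<^bsub>free_algebra X\<^esub> (p + p') = r \<otimes>\<^bsub>free_algebra X\<^esub> p + r \<otimes>\<^bsub>free_algebra X\<^esub> p'"
  "0 \<otimes>\<^bsub>free_algebra X\<^esub> r = 0" "r \<otimes>\<^bsub>free_algebra X\<^esub> 0 = 0"
  by (simp_all add: free_algebra_def ma_mult_ladd ma_mult_radd)

lemma sort_append_sort: "sort (sort u @ sort v) = sort (u @ v)"
  by (rule properties_for_sort) simp_all

text \<open>By bilinearity it is enough to compare two words, where the claim is
  \<open>reorder_coeff_append_sort\<close>.\<close>

lemma reorder_mult:
  assumes "p \<in> carrier (free_algebra X)" "r \<in> carrier (free_algebra X)"
  shows "reorder q (p \<otimes>\<^bsub>free_algebra X\<^esub> r) = reorder q (reorder q p \<otimes>\<^bsub>free_algebra X\<^esub> reorder q r)"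
  using assms(1)
proof (induction p rule: free_induct)
  case p: (single u c)
  from assms(2) show ?case
  proof (induction r rule: free_induct)
    case (single v d)
    have "reorder_coeff q (u @ v) =
        reorder_coeff q u * reorder_coeff q v * reorder_coeff q (sort u @ sort v)"
      by (rule reorder_coeff_append_sort)
    then show ?case by (simp add: sort_append_sort mult_ac)
  qed (simp_all add: free_distrib reorder_add)
qed (simp_all add: free_distrib reorder_add)

text \<open>Absorption follows from \<open>reorder_mult\<close>: if one factor sorts to 0, the
  product sorts to the same element as 0 does.\<close>

lemma reorder_zero_ideal: "ideal {p \<in> carrier (free_algebra X). reorder q p = 0} (free_algebra X)"
proof -
  interpret F: calgebra "free_algebra X" by (rule free_calgebra)
  let ?K = "{p \<in> carrier (free_algebra X). reorder q p = 0}"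
  have u: "\<ominus>\<^bsub>free_algebra X\<^esub> a = - a" if "a \<in> carrier (free_algebra X)" for a
    using free_minus[OF F.zero_closed that] that F.minus_eq[of "\<zero>\<^bsub>free_algebra X\<^esub>" a] F.l_zero[OF F.a_inv_closed[OF that]] by simp
  show ?thesis
  proof (rule idealI[OF F.ring_axioms])
    show "subgroup ?K (add_monoid (free_algebra X))"
    proof (rule group.subgroupI[OF F.a_group])
      have "0 \<in> ?K" by simp
      then show "?K \<noteq> {}" by blast
      fix a b assume a: "a \<in> ?K" 
      have "reorder q (- a) = 0" using a reorder_diff[of q 0 a] by simp
      then show "inv\<^bsub>add_monoid (free_algebra X)\<^esub> a \<in> ?K"
        using a u[of a] unfolding a_inv_def by simp
      assume b: "b \<in> ?K"
      then show "a \<otimes>\<^bsub>add_monoid (free_algebra X)\<^esub> b \<in> ?K"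
        using a by (simp add: reorder_add keys_plusI)
    qed auto
  next
    fix a x assume a: "a \<in> ?K" and x: "x \<in> carrier (free_algebra X)"
    show "x \<otimes>\<^bsub>free_algebra X\<^esub> a \<in> ?K" "a \<otimes>\<^bsub>free_algebra X\<^esub> x \<in> ?K"
      using a x F.m_closed[of x a] F.m_closed[of a x] reorder_mult[of x X a q] reorder_mult[of a X x q]
      by (simp_all add: free_distrib)
  qed
qed

text \<open>The word \<open>[j, i]\<close> has a single inversion, with factor \<open>q j i\<close>,
  so each defining relation sorts to 0, and minimality of the generated ideal does the rest. This is
  the linear independence of the ordered monomials in the quantum space: by
  \<open>reorder_ordered\<close>, an element of the ideal supported on them is 0.\<close>

lemma quantum_ideal_reorder:
  assumes "p \<in> quantum_ideal X q"
  shows "reorder q p = 0"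
proof -
  have "quantum_ideal X q \<subseteq> {p \<in> carrier (free_algebra X). reorder q p = 0}"
    unfolding quantum_ideal_def
  proof (rule ring.genideal_minimal[OF calgebra.axioms(1)[OF free_calgebra] reorder_zero_ideal], safe)
    fix i j assume ij: "i \<in> X" "j \<in> X" "i < j"
    show "Poly_Mapping.single [j, i] 1 - Poly_Mapping.single [i, j] (q j i) \<in> carrier (free_algebra X)"
      using quantum_rels_carrier[of q X] ij by blast
    show "reorder q (Poly_Mapping.single [j, i] 1 - Poly_Mapping.single [i, j] (q j i)) = 0"
      using ij(3) less_imp_le[OF ij(3)] less_not_sym[OF ij(3)] by (simp add: reorder_diff)
  qed
  then show ?thesis using assms by blast
qed

section \<open>Residue classes and their ordered representatives\<close>

definition quantum_class :: "'x::linorder set \<Rightarrow> ('x \<Rightarrow> 'x \<Rightarrow> complex) \<Rightarrow> ('x list \<Rightarrow>\<^sub>0 complex) \<Rightarrow>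
    ('x list \<Rightarrow>\<^sub>0 complex) set" where
  "quantum_class X q p = quantum_ideal X q +>\<^bsub>free_algebra X\<^esub> p"

lemma quantum_class_hom: "quantum_class X q \<in> calg_hom (free_algebra X) (quantum_space X q)"
  unfolding quantum_class_def[abs_def] quantum_space_def
  by (rule quot_proj[OF free_calgebra quantum_ideal_ideal])

lemma quantum_carrier: "carrier (quantum_space X q) = quantum_class X q ` carrier (free_algebra X)"
  unfolding quantum_class_def[abs_def] quantum_space_def
  by (rule quot_carrier[OF free_calgebra quantum_ideal_ideal])

lemma quantum_zero: "\<zero>\<^bsub>quantum_space X q\<^esub> = quantum_class X q 0"
  using quot_zero[OF free_calgebra quantum_ideal_ideal, of X q]
  unfolding quantum_class_def quantum_space_def by simp

lemma quantum_class_eq_iff: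
  assumes "p \<in> carrier (free_algebra X)" "r \<in> carrier (free_algebra X)"
  shows "quantum_class X q p = quantum_class X q r \<longleftrightarrow> p - r \<in> quantum_ideal X q"
  unfolding quantum_class_def
  using quot_eq_iff[OF free_calgebra quantum_ideal_ideal assms] free_minus[OF assms] by simp

lemma quantum_class_gen: "quantum_class X q (Poly_Mapping.single [x] 1) = quantum_gen X q x"
  by (simp add: quantum_class_def quantum_gen_def)

lemma quantum_class_Cons:
  assumes "x \<in> X" "w \<in> lists X"
  shows "quantum_class X q (Poly_Mapping.single (x # w) 1) =
    quantum_gen X q x \<otimes>\<^bsub>quantum_space X q\<^esub> quantum_class X q (Poly_Mapping.single w 1)"
  using calg_homD(2)[OF quantum_class_hom, of "Poly_Mapping.single [x] 1" X "Poly_Mapping.single w 1" q] assms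
  by (simp add: quantum_class_gen)

lemma quantum_class_smult:
  assumes "p \<in> carrier (free_algebra X)"
  shows "quantum_class X q (Poly_Mapping.map ((*) c) p) = c \<odot>\<^bsub>quantum_space X q\<^esub> quantum_class X q p"
  using calg_homD(5)[OF quantum_class_hom assms, of q c] by simp

lemma quantum_class_add:
  assumes "p \<in> carrier (free_algebra X)" "r \<in> carrier (free_algebra X)"
  shows "quantum_class X q (p + r) = quantum_class X q p \<oplus>\<^bsub>quantum_space X q\<^esub> quantum_class X q r"
  using calg_homD(3)[OF quantum_class_hom assms, of q] by simp

text \<open>The letter \<open>x\<close> moves to the right past the smaller letters at the front of
  \<open>w\<close>, each exchange costing one factor. It stops at the first letter that is not
  smaller, and since \<open>w\<close> is sorted no inversion with \<open>x\<close> is left.\<close>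

lemma quantum_class_insort:
  assumes "x \<in> X" "w \<in> lists X" "sorted w"
  shows "quantum_class X q (Poly_Mapping.single (x # w) 1) =
    reorder_coeff q (x # w) \<odot>\<^bsub>quantum_space X q\<^esub> quantum_class X q (Poly_Mapping.single (insort x w) 1)"
  using assms(2,3)
proof (induction w)
  case Nil
  interpret Q: calgebra "quantum_space X q" by (rule quantum_calgebra)
  from assms(1) show ?case by (simp add: quantum_class_gen quantum_gen_closed)
next
  case (Cons y w)
  interpret Q: calgebra "quantum_space X q" by (rule quantum_calgebra)
  have c: "quantum_class X q (Poly_Mapping.single u 1) \<in> carrier (quantum_space X q)" if "u \<in> lists X" for u
    using that by (auto simp: quantum_carrier)
  have y: "y \<in> X" "w \<in> lists X" using Cons by auto
  have i: "insort x w \<in> lists X" using y assms by (auto simp: in_lists_conv_set set_insort_key)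
  note g = quantum_gen_closed[OF assms(1), of q] quantum_gen_closed[OF y(1), of q]
  show ?case
  proof (cases "x \<le> y")
    case True
    then have "sorted (x # y # w)" using Cons by auto
    then have "reorder_coeff q (x # y # w) = 1" by (rule reorder_coeff_sorted)
    then show ?thesis using True assms y c[of "x # y # w"] by simp
  next
    case False
    let ?w = "quantum_class X q (Poly_Mapping.single w 1)"
    have "quantum_class X q (Poly_Mapping.single (x # y # w) 1) =
        (quantum_gen X q x \<otimes>\<^bsub>quantum_space X q\<^esub> quantum_gen X q y) \<otimes>\<^bsub>quantum_space X q\<^esub> ?w"
      using assms y c g by (simp add: quantum_class_Cons Q.m_assoc)
    also have "\<dots> = q x y \<odot>\<^bsub>quantum_space X q\<^esub>
        (quantum_gen X q y \<otimes>\<^bsub>quantum_space X q\<^esub> (quantum_gen X q x \<otimes>\<^bsub>quantum_space X q\<^esub> ?w))"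
      using assms y c g False
      by (simp add: quantum_gen_rel Q.sm_ml Q.m_assoc)
    also have "quantum_gen X q x \<otimes>\<^bsub>quantum_space X q\<^esub> ?w = reorder_coeff q (x # w) \<odot>\<^bsub>quantum_space X q\<^esub>
        quantum_class X q (Poly_Mapping.single (insort x w) 1)"
      using Cons assms y by (simp flip: quantum_class_Cons)
    also have "quantum_gen X q y \<otimes>\<^bsub>quantum_space X q\<^esub> \<dots> = reorder_coeff q (x # w) \<odot>\<^bsub>quantum_space X q\<^esub>
        quantum_class X q (Poly_Mapping.single (y # insort x w) 1)"
      using g c i y by (simp add: Q.sm_mr quantum_class_Cons)
    also have "q x y \<odot>\<^bsub>quantum_space X q\<^esub> \<dots> = (q x y * reorder_coeff q (x # w)) \<odot>\<^bsub>quantum_space X q\<^esub>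
        quantum_class X q (Poly_Mapping.single (y # insort x w) 1)"
      using c i y by (simp add: Q.sm_assoc)
    \<comment> \<open>The tails \<open>y # w\<close> and \<open>w\<close> are sorted and contribute
      1, so only the factors of \<open>x\<close> remain on both sides.\<close>
    also have "q x y * reorder_coeff q (x # w) = reorder_coeff q (x # y # w)"
      using False Cons.prems reorder_coeff_sorted[of "y # w" q] reorder_coeff_sorted[of w q] by (simp add: not_le)
    finally show ?thesis using False by simp
  qed
qed

text \<open>Insertion sort: the induction hypothesis sorts the tail, and
  \<open>quantum_class_insort\<close> puts the head in its place.\<close>

lemma quantum_class_sort:
  assumes "w \<in> lists X"
  shows "quantum_class X q (Poly_Mapping.single w 1) =
    reorder_coeff q w \<odot>\<^bsub>quantum_space X q\<^esub> quantum_class X q (Poly_Mapping.single (sort w) 1)"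
  using assms
proof (induction w)
  case Nil
  interpret Q: calgebra "quantum_space X q" by (rule quantum_calgebra)
  show ?case by (simp add: quantum_carrier)
next
  case (Cons x w)
  interpret Q: calgebra "quantum_space X q" by (rule quantum_calgebra)
  have c: "quantum_class X q (Poly_Mapping.single u 1) \<in> carrier (quantum_space X q)" if "u \<in> lists X" for u
    using that by (auto simp: quantum_carrier)
  have s: "sort w \<in> lists X" "insort x (sort w) \<in> lists X"
    using Cons by (auto simp: in_lists_conv_set set_insort_key)
  have "quantum_class X q (Poly_Mapping.single (x # w) 1) = reorder_coeff q w \<odot>\<^bsub>quantum_space X q\<^esub>
     (quantum_gen X q x \<otimes>\<^bsub>quantum_space X q\<^esub> quantum_class X q (Poly_Mapping.single (sort w) 1))"
    using Cons s c quantum_gen_closed[of x X q] by (simp add: quantum_class_Cons Q.sm_mr)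
  also have "\<dots> = reorder_coeff q w \<odot>\<^bsub>quantum_space X q\<^esub> quantum_class X q (Poly_Mapping.single (x # sort w) 1)"
    using Cons s by (simp add: quantum_class_Cons)
  also have "\<dots> = (reorder_coeff q w * reorder_coeff q (x # sort w)) \<odot>\<^bsub>quantum_space X q\<^esub>
      quantum_class X q (Poly_Mapping.single (insort x (sort w)) 1)"
    using Cons s c by (subst quantum_class_insort) (simp_all add: Q.sm_assoc)
  also have "reorder_coeff q w * reorder_coeff q (x # sort w) = reorder_coeff q (x # w)"
    using reorder_coeff_append_sort[of q "[x]" w] by (auto simp: mult_ac)
  finally show ?case by simp
qed

text \<open>The linear extension of \<open>quantum_class_sort\<close>, which shows that the ordered
  monomials span. Combined with \<open>quantum_ideal_reorder\<close>, it identifies the elements of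
  the free algebra that sort to 0 with the defining ideal.\<close>

lemma quantum_class_reorder:
  assumes "p \<in> carrier (free_algebra X)"
  shows "quantum_class X q (reorder q p) = quantum_class X q p"
  using assms
proof (induction p rule: free_induct)
  case (single w c)
  interpret Q: calgebra "quantum_space X q" by (rule quantum_calgebra)
  have m: "quantum_class X q (Poly_Mapping.single u d) =
      d \<odot>\<^bsub>quantum_space X q\<^esub> quantum_class X q (Poly_Mapping.single u 1)" if "u \<in> lists X" for u d
    using quantum_class_smult[of "Poly_Mapping.single u 1" X q d] that by simp
  have "sort w \<in> lists X" using single by (auto simp: in_lists_conv_set)
  moreover from this have "quantum_class X q (Poly_Mapping.single (sort w) 1) \<in> carrier (quantum_space X q)"
    by (auto simp: quantum_carrier)
  ultimately show ?case
    using single m[of w c] quantum_class_sort[OF single, of q] m[of "sort w" "c * reorder_coeff q w"]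
    by (simp add: Q.sm_assoc)
next
  case (add p r)
  then show ?case by (simp only: reorder_add quantum_class_add reorder_closed)
qed simp

text \<open>The sorted element lies in the class by \<open>quantum_class_reorder\<close>. Any other
  ordered element of the class differs from \<open>p\<close> by an element of the ideal, hence has
  the same sorting, and it is its own sorting.\<close>

lemma ordered_form_class:
  assumes "p \<in> carrier (free_algebra X)"
  shows "ordered_form X (quantum_class X q p) = reorder q p"
  unfolding ordered_form_def
proof (rule the_equality)
  note qi = free_calgebra[of X] quantum_ideal_ideal[of X q]
  have "reorder q p \<in> quantum_class X q (reorder q p)"
    unfolding quantum_class_def by (rule quot_self[OF qi reorder_closed[OF assms]])
  then show "reorder q p \<in> quantum_class X q p \<and> Poly_Mapping.keys (reorder q p) \<subseteq> ordered_monomials X"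
    using assms by (simp add: quantum_class_reorder reorder_keys)
  fix r assume r: "r \<in> quantum_class X q p \<and> Poly_Mapping.keys r \<subseteq> ordered_monomials X"
  have "r \<in> carrier (free_algebra X)" "quantum_class X q r = quantum_class X q p"
    using r quot_memD[OF qi assms, of r] unfolding quantum_class_def by auto
  then have "r - p \<in> quantum_ideal X q" using quantum_class_eq_iff assms by blast
  then have "reorder q r = reorder q p" using quantum_ideal_reorder[of "r - p"] by (simp add: reorder_diff)
  then show "r = reorder q p" using r reorder_ordered by metis
qed

lemma ordered_form_add:
  assumes "a \<in> carrier (quantum_space X q)" "b \<in> carrier (quantum_space X q)"
  shows "ordered_form X (a \<oplus>\<^bsub>quantum_space X q\<^esub> b) = ordered_form X a + ordered_form X b"
proof -
  obtain p r where pr: "p \<in> carrier (free_algebra X)" "r \<in> carrier (free_algebra X)"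
    "a = quantum_class X q p" "b = quantum_class X q r"
    using assms by (auto simp only: quantum_carrier)
  have "p + r \<in> carrier (free_algebra X)" using pr by (simp add: keys_plusI)
  then show ?thesis
    using pr by (simp only: ordered_form_class reorder_add flip: quantum_class_add)
qed

lemma ordered_form_smult:
  assumes "a \<in> carrier (quantum_space X q)"
  shows "ordered_form X (c \<odot>\<^bsub>quantum_space X q\<^esub> a) = Poly_Mapping.map ((*) c) (ordered_form X a)"
proof -
  obtain p where p: "p \<in> carrier (free_algebra X)" "a = quantum_class X q p"
    using assms by (auto simp only: quantum_carrier)
  have "Poly_Mapping.map ((*) c) p \<in> carrier (free_algebra X)" using p keys_map_mult[of c p] by auto
  then show ?thesis
    using p by (simp only: ordered_form_class reorder_smult flip: quantum_class_smult)
qed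

lemma quantum_class_ordered_form:
  assumes "h \<in> carrier (quantum_space X q)"
  shows "quantum_class X q (ordered_form X h) = h" "Poly_Mapping.keys (ordered_form X h) \<subseteq> ordered_monomials X"
proof -
  obtain p where p: "p \<in> carrier (free_algebra X)" "h = quantum_class X q p"
    using assms by (auto simp only: quantum_carrier)
  then show "quantum_class X q (ordered_form X h) = h"
    "Poly_Mapping.keys (ordered_form X h) \<subseteq> ordered_monomials X"
    by (simp_all only: ordered_form_class quantum_class_reorder reorder_keys)
qed

section \<open>Leading monomials\<close>

lemma deglex_trans: "trans (deglex :: 'x::linorder list rel)"
  unfolding deglex_def by (intro lenlex_transI transI) auto

lemma deglex_total: "u \<noteq> v \<Longrightarrow> (u, v) \<in> deglex \<or> (v, u) \<in> deglex"
proof -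
  have "total {(x, y). x < (y :: 'a)}" by (auto simp: total_on_def)
  then show "u \<noteq> v \<Longrightarrow> (u, v) \<in> deglex \<or> (v, u) \<in> deglex"
    using total_lenlex unfolding deglex_def total_on_def by blast
qed

lemma deglex_irrefl: "(u, u) \<notin> deglex"
  unfolding deglex_def by (rule lenlex_irreflexive) auto

lemma deglex_asym: "(u, v) \<in> deglex \<Longrightarrow> (v, u) \<notin> deglex"
  using deglex_irrefl transD[OF deglex_trans] by metis

lemma deglex_max_exists:
  assumes "finite S" "S \<noteq> {}"
  shows "\<exists>w\<in>S. \<forall>v\<in>S. v \<noteq> w \<longrightarrow> (v, w) \<in> deglex"
  using assms
proof (induction S rule: finite_ne_induct)
  case (insert x S)
  then obtain w where w: "w \<in> S" "\<And>v. v \<in> S \<Longrightarrow> v \<noteq> w \<Longrightarrow> (v, w) \<in> deglex" by blast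
  consider "x = w" | "(x, w) \<in> deglex" | "(w, x) \<in> deglex" using deglex_total by blast
  then show ?case
  proof cases
    case 3
    have "(v, x) \<in> deglex" if "v \<in> insert x S" "v \<noteq> x" for v
      using that w(2)[of v] 3 transD[OF deglex_trans] by (cases "v = w") blast+
    then show ?thesis by blast
  next
    case 1
    then show ?thesis using w by (intro bexI[of _ w]) auto
  next
    case 2
    then show ?thesis using w by (intro bexI[of _ w]) auto
  qed
qed simp

lemma leading_monomial_eq:
  assumes "w \<in> Poly_Mapping.keys (ordered_form X h)"
    "\<And>v. v \<in> Poly_Mapping.keys (ordered_form X h) \<Longrightarrow> v \<noteq> w \<Longrightarrow> (v, w) \<in> deglex"
  shows "leading_monomial X h = w"
  unfolding leading_monomial_def
proof (rule the_equality)
  let ?K = "Poly_Mapping.keys (ordered_form X h)"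
  show "w \<in> ?K \<and> (\<forall>v\<in>?K. v \<noteq> w \<longrightarrow> (v, w) \<in> deglex)" using assms by blast
  fix v assume v: "v \<in> ?K \<and> (\<forall>u\<in>?K. u \<noteq> v \<longrightarrow> (u, v) \<in> deglex)"
  show "v = w"
  proof (rule ccontr)
    assume "v \<noteq> w"
    then have "(v, w) \<in> deglex" "(w, v) \<in> deglex" using v assms by auto
    then show False using deglex_asym by blast
  qed
qed

lemma leading_monomial_max:
  assumes "ordered_form X h \<noteq> 0"
  shows "leading_monomial X h \<in> Poly_Mapping.keys (ordered_form X h)"
    "\<And>v. v \<in> Poly_Mapping.keys (ordered_form X h) \<Longrightarrow> v \<noteq> leading_monomial X h \<Longrightarrow>
      (v, leading_monomial X h) \<in> deglex"
proof -
  have "Poly_Mapping.keys (ordered_form X h) \<noteq> {}" using assms by simp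
  from deglex_max_exists[OF finite_keys this]
  obtain w where w: "w \<in> Poly_Mapping.keys (ordered_form X h)"
    "\<And>v. v \<in> Poly_Mapping.keys (ordered_form X h) \<Longrightarrow> v \<noteq> w \<Longrightarrow> (v, w) \<in> deglex" by blast
  have e: "leading_monomial X h = w" by (rule leading_monomial_eq[OF w])
  show "leading_monomial X h \<in> Poly_Mapping.keys (ordered_form X h)" unfolding e by (rule w(1))
  show "(v, leading_monomial X h) \<in> deglex"
    if "v \<in> Poly_Mapping.keys (ordered_form X h)" "v \<noteq> leading_monomial X h" for v
    using w(2)[of v] that unfolding e by blast
qed

text \<open>The head of a sorted word is its smallest letter: either it is smaller than the head of
  \<open>v\<close>, or the heads agree and the tails are compared.\<close>

lemma lex_sorted_least:
  fixes u v :: "'x::linorder list"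
  assumes "sorted u" "mset u = mset v" "u \<noteq> v"
  shows "(u, v) \<in> lex {(x, y). x < y}"
  using assms
proof (induction u arbitrary: v)
  case (Cons x u)
  then obtain y v' where v: "v = y # v'" by (cases v) auto
  have len: "length u = length v'" using mset_eq_length[OF Cons.prems(2)] v by simp
  have "set v = insert x (set u)" using mset_eq_setD[OF Cons.prems(2)] by simp
  then have "x \<le> y" using Cons.prems(1) v by auto
  then show ?case using Cons v len by (cases "x = y") auto
qed simp

text \<open>With equal first components, the order on pairs compares second components, so the first
  difference of the words is the first difference of their second components.\<close>

lemma lex_map_snd:
  fixes u v :: "('x::linorder \<times> 'y::linorder) list"
  assumes "map fst u = map fst v" "(map snd u, map snd v) \<in> lex {(x, y). x < y}"
  shows "(u, v) \<in> lex {(x, y). x < y}"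
  using assms
proof (induction u arbitrary: v)
  case (Cons x u)
  then obtain y v' where v: "v = y # v'" by (cases v) auto
  have len: "length u = length v'" using Cons.prems(1) v by (auto dest: map_eq_imp_length_eq)
  show ?case
    using Cons v len by (auto simp: less_prod_def intro: prod_eqI)
qed simp

lemma sorted_map_fst:
  fixes v :: "('x::linorder \<times> 'y::linorder) list"
  assumes "sorted v"
  shows "sorted (map fst v)"
  using assms unfolding sorted_map
  by (rule sorted_wrt_mono_rel[rotated]) (auto simp: less_eq_prod_def)

text \<open>Being sorted, the first components of both words are determined by their common multiset
  and so coincide; the comparison is left to the second components, where the sorted arrangement is
  least. Equal lengths reduce \<open>deglex\<close> to the lexicographic order.\<close>

lemma deglex_sorted_components_least:
  fixes u v :: "('x::linorder \<times> 'y::linorder) list"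
  assumes v: "sorted v" and u: "sorted (map fst u)" "sorted (map snd u)"
    and e: "mset (map fst u) = mset (map fst v)" "mset (map snd u) = mset (map snd v)"
    and ne: "u \<noteq> v"
  shows "(u, v) \<in> deglex"
proof -
  have f: "map fst u = map fst v" using sorted_map_fst[OF v] u(1) e(1) by (metis properties_for_sort sorted_sort_id)
  have len: "length u = length v" using f by (rule map_eq_imp_length_eq)
  have "map snd u \<noteq> map snd v" using f ne by (metis zip_map_fst_snd)
  from lex_sorted_least[OF u(2) e(2) this]
  have "(map snd u, map snd v) \<in> lex {(x, y). x < y}" .
  from lex_map_snd[OF f this] len show ?thesis by (simp add: deglex_def lenlex_conv)
qed

text \<open>A descent of the second components in a sorted word forces a strict increase of the
  first ones, because pairs with equal first components are ordered by their second.\<close>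

lemma obtain_inversion:
  fixes w :: "('x::linorder \<times> 'y::linorder) list"
  assumes "sorted w" "\<not> sorted (map snd w)"
  obtains i j \<alpha> \<beta> where "i < j" "\<alpha> < \<beta>" "mset [(i, \<beta>), (j, \<alpha>)] \<subseteq># mset w"
proof -
  from assms(2) obtain k l where kl: "k < l" "l < length w" "snd (w ! l) < snd (w ! k)"
    by (auto simp: sorted_iff_nth_mono_less not_le)
  have "w ! k \<le> w ! l" using assms(1) kl by (simp add: sorted_nth_mono)
  then have "fst (w ! k) < fst (w ! l)" using kl(3) by (auto simp: less_eq_prod_def)
  \<comment> \<open>The multiset inclusion needs two separate occurrences; cutting the word at
    \<open>l\<close> leaves position \<open>k\<close> inside the prefix.\<close>
  moreover have "mset [w ! k, w ! l] \<subseteq># mset w"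
  proof -
    have "w = take l w @ w ! l # drop (Suc l) w" using kl by (simp add: id_take_nth_drop)
    then have "mset w = mset (take l w) + {#w ! l#} + mset (drop (Suc l) w)"
      by (metis mset_append mset.simps(2) add_mset_add_single union_assoc union_commute)
    moreover have "w ! k \<in># mset (take l w)"
      using kl by (auto simp: in_set_conv_nth intro!: exI[of _ k])
    then have "{#w ! k#} \<subseteq># mset (take l w)" by simp
    ultimately show ?thesis
      by (simp add: add_mset_commute subset_mset.add_mono subset_mset.add_increasing2)
  qed
  ultimately show ?thesis
    using that[of "fst (w ! k)" "fst (w ! l)" "snd (w ! l)" "snd (w ! k)"] kl by simp
qed

text \<open>Exponent vectors are multisets of letters, so divisibility with respect to
  \<open>star\<close> is multiset inclusion and the cofactor is the sorted difference.\<close>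

lemma star_quotient:
  fixes v w :: "'x::linorder list"
  assumes "w \<in> ordered_monomials X" "mset v \<subseteq># mset w"
  shows "\<exists>u\<in>ordered_monomials X. w = star u v"
proof
  let ?u = "sorted_list_of_multiset (mset w - mset v)"
  have "set ?u \<subseteq> set w" by (auto dest: in_diffD)
  then show "?u \<in> ordered_monomials X"
    using assms(1) by (auto simp: ordered_monomials_def in_lists_conv_set)
  have "mset (?u @ v) = mset w" using assms(2) by (simp add: subset_mset.diff_add)
  then have "sort (?u @ v) = w"
    using assms(1) by (intro properties_for_sort) (auto simp: ordered_monomials_def)
  then show "w = star ?u v" by (simp add: star_def)
qed

text \<open>The cofactor has length 0, so a monomial divides another of the same degree only if they
  are equal.\<close>

lemma star_eq_length:
  assumes "w = star u v" "length w = length v" "sorted v"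
  shows "w = v"
proof -
  have "length w = length u + length v" using assms(1) by (simp add: star_def)
  then show ?thesis using assms by (simp add: star_def sorted_sort_id)
qed

section \<open>The Segre map\<close>

text \<open>On the tensor product this is the functional dual to the pair of ordered monomials
  \<open>u\<close> and \<open>v\<close>, written on representatives in the free vector space on
  pairs.\<close>

definition tensor_coeff :: "'x::linorder set \<Rightarrow> 'y::linorder set \<Rightarrow> 'x list \<Rightarrow> 'y list \<Rightarrow>
    (('x list \<Rightarrow>\<^sub>0 complex) set \<times> ('y list \<Rightarrow>\<^sub>0 complex) set \<Rightarrow>\<^sub>0 complex) \<Rightarrow> complex" where
  "tensor_coeff X Y u v = linear_form (\<lambda>(a, b).
     Poly_Mapping.lookup (ordered_form X a) u * Poly_Mapping.lookup (ordered_form Y b) v)"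

text \<open>Coefficients of ordered forms are linear, so the functional is bilinear in the pair and
  kills all four kinds of bilinearity relations. Its zero set is a subspace and therefore contains
  their span. Thus the coefficients are well defined on the tensor product.\<close>

lemma tensor_coeff_ideal:
  assumes "P \<in> tensor_ideal (quantum_space X q) (quantum_space Y q')"
  shows "tensor_coeff X Y u v P = 0"
proof -
  let ?A = "quantum_space X q" and ?B = "quantum_space Y q'"
  let ?M = "monoid_algebra (?A \<times>\<times> ?B)"
  note AB = quantum_calgebra[of X q] quantum_calgebra[of Y q']
  interpret M: calgebra ?M by (rule ma_calgebra[OF tensor_monoid[OF AB]])
  let ?W = "{P \<in> carrier ?M. tensor_coeff X Y u v P = 0}"
  have "tensor_ideal ?A ?B \<subseteq> ?W"
  proof (rule tensor_ideal_minimal[OF AB])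
    have inv: "\<ominus>\<^bsub>?M\<^esub> a = - a" if "a \<in> carrier ?M" for a
      using ma_minus[OF tensor_monoid[OF AB], of 0 a] that M.minus_eq[of "\<zero>\<^bsub>?M\<^esub>" a]
        M.l_zero[OF M.a_inv_closed[OF that]] by simp
    show "additive_subgroup ?W ?M"
    proof (rule additive_subgroupI, rule group.subgroupI[OF M.a_group])
      have "0 \<in> ?W" by (simp add: tensor_coeff_def)
      then show "?W \<noteq> {}" by blast
      fix a b assume a: "a \<in> ?W"
      have "tensor_coeff X Y u v (- a) = 0"
        using a linear_form_diff[of _ 0 a] by (simp add: tensor_coeff_def)
      then show "inv\<^bsub>add_monoid ?M\<^esub> a \<in> ?W"
        using a inv[of a] unfolding a_inv_def by simp
      assume "b \<in> ?W"
      then show "a \<otimes>\<^bsub>add_monoid ?M\<^esub> b \<in> ?W"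
        using a by (simp add: tensor_coeff_def linear_form_add keys_plusI)
    qed auto
    show "Poly_Mapping.map ((*) c) P \<in> ?W" if "P \<in> ?W" for c P
      using that M.sm_closed[of P c] by (simp add: tensor_coeff_def linear_form_smult)
    show "tensor_relations ?A ?B \<subseteq> ?W"
    proof
      fix r assume r: "r \<in> tensor_relations ?A ?B"
      have "tensor_coeff X Y u v r = 0"
        by (rule tensor_rel_cases[OF AB r])
          (simp_all add: tensor_coeff_def linear_form_diff ordered_form_add ordered_form_smult
            lookup_add lookup_map_mult distrib_left distrib_right)
      then show "r \<in> ?W" using r tensor_rels_carrier[OF AB] by blast
    qed
  qed
  then show ?thesis using assms by blast
qed

lemma quantum_class_Nil: "quantum_class X q (Poly_Mapping.single [] 1) = \<one>\<^bsub>quantum_space X q\<^esub>"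
  using calg_homD(4)[OF quantum_class_hom, of X q] by simp

lemma quantum_class_word_closed:
  "w \<in> lists X \<Longrightarrow> quantum_class X q (Poly_Mapping.single w 1) \<in> carrier (quantum_space X q)"
  by (auto simp: quantum_carrier)

lemma segre_map:
  assumes "mult_antisym n q" and "mult_antisym m q'"
  shows "is_segre_map n m q q' (segre_map n m q q')"
  unfolding segre_map_def by (rule theI'[OF segre_map_unique[OF assms]])

text \<open>A representative in the free algebra of one Segre relation. The indices are grouped as a
  pair of rows and a pair of columns, so that the relations are indexed by a cartesian
  product.\<close>

definition segre_binomial :: "(nat \<Rightarrow> nat \<Rightarrow> complex) \<Rightarrow> (nat \<times> nat) \<times> (nat \<times> nat) \<Rightarrow>
    (nat \<times> nat) list \<Rightarrow>\<^sub>0 complex" where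
  "segre_binomial q' = (\<lambda>((i, j), (\<alpha>, \<beta>)).
     Poly_Mapping.single [(i, \<beta>), (j, \<alpha>)] 1 - Poly_Mapping.single [(i, \<alpha>), (j, \<beta>)] (q' \<beta> \<alpha>))"

lemma keys_binomial:
  assumes "u \<noteq> v" "c \<noteq> (0::complex)"
  shows "Poly_Mapping.keys (Poly_Mapping.single u 1 - Poly_Mapping.single v c) = {u, v}"
  using assms by (auto simp: in_keys_iff lookup_minus lookup_single when_def split: if_splits)

definition increasing_pairs :: "nat \<Rightarrow> (nat \<times> nat) set" where
  "increasing_pairs n = {(i, j). i < j \<and> j \<le> n}"

lemma card_increasing_pairs: "card (increasing_pairs n) = (n + 1) choose 2"
proof -
  \<comment> \<open>After transposition the larger entry \<open>j\<close> comes first, and the fibre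
    over it has \<open>j\<close> elements.\<close>
  have "increasing_pairs n = (SIGMA j:{..n}. {..<j}) \<inverse>"
    by (auto simp: increasing_pairs_def)
  then have "card (increasing_pairs n) = card (SIGMA j:{..n}. {..<j})"
    by (simp add: card_inverse)
  also have "\<dots> = \<Sum>{..n}" by simp
  also have "\<dots> = (n + 1) choose 2" by (simp add: gauss_sum_nat choose_two atMost_atLeast0)
  finally show ?thesis .
qed

section \<open>The Segre map on representatives\<close>

context
  fixes n m :: nat and q q' :: "nat \<Rightarrow> nat \<Rightarrow> complex"
  assumes q: "mult_antisym n q" and q': "mult_antisym m q'"
begin

private abbreviation (input) "Z \<equiv> segre_index n m"
private abbreviation (input) "g \<equiv> segre_matrix q q'"
private abbreviation (input) "A \<equiv> quantum_space {..n} q"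
private abbreviation (input) "B \<equiv> quantum_space {..m} q'"
private abbreviation (input) "Q \<equiv> quantum_space Z g"
private abbreviation (input) "T \<equiv> tensor_algebra A B"
private abbreviation (input) "s \<equiv> segre_map n m q q'"
private abbreviation (input) "I \<equiv> increasing_pairs n \<times> increasing_pairs m"
private abbreviation (input) "b x \<equiv> quantum_class Z g (segre_binomial q' x)"

interpretation A: calgebra A by (rule quantum_calgebra)
interpretation B: calgebra B by (rule quantum_calgebra)
interpretation Q: calgebra Q by (rule quantum_calgebra)
interpretation T: calgebra T by (rule tensor_calgebra[OF A.calgebra_axioms B.calgebra_axioms])

lemma segre_map_hom: "s \<in> calg_hom Q T"
  using segre_map[OF q q'] by (simp add: is_segre_map_def)

interpretation s: ring_hom_ring Q T s
  by (rule calg_hom_ring[OF Q.calgebra_axioms T.calgebra_axioms segre_map_hom])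

text \<open>The Segre map is multiplicative and pure tensors multiply componentwise, so the rows and
  the columns of a word separate.\<close>

lemma segre_map_word:
  assumes "w \<in> lists Z"
  shows "s (quantum_class Z g (Poly_Mapping.single w 1)) = pure_tensor A B
    (quantum_class {..n} q (Poly_Mapping.single (map fst w) 1))
    (quantum_class {..m} q' (Poly_Mapping.single (map snd w) 1))"
  using assms
proof (induction w)
  case Nil
  have "\<one>\<^bsub>T\<^esub> = pure_tensor A B \<one>\<^bsub>A\<^esub> \<one>\<^bsub>B\<^esub>"
    unfolding tensor_algebra_def pure_tensor_def
      quot_one[OF ma_calgebra[OF tensor_monoid[OF A.calgebra_axioms B.calgebra_axioms]]
        tensor_ideal_ideal[OF A.calgebra_axioms B.calgebra_axioms]]
    by simp
  then show ?case using calg_homD(4)[OF segre_map_hom] by (simp add: quantum_class_Nil)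
next
  case (Cons z w)
  obtain i \<alpha> where z: "z = (i, \<alpha>)" by (cases z)
  have l: "i \<le> n" "\<alpha> \<le> m" using Cons z by (auto simp: segre_index_def)
  have w: "map fst w \<in> lists {..n}" "map snd w \<in> lists {..m}"
    using Cons.hyps by (auto simp: segre_index_def in_lists_conv_set)
  have "s (quantum_class Z g (Poly_Mapping.single (z # w) 1)) =
    s (quantum_gen Z g z) \<otimes>\<^bsub>T\<^esub> s (quantum_class Z g (Poly_Mapping.single w 1))"
    using Cons quantum_class_word_closed[of w Z g] quantum_gen_closed[of z Z g]
    by (simp add: quantum_class_Cons calg_homD(2)[OF segre_map_hom])
  also have "s (quantum_gen Z g z) = pure_tensor A B (quantum_gen {..n} q i) (quantum_gen {..m} q' \<alpha>)"
    using segre_map[OF q q'] l z by (simp add: is_segre_map_def)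
  finally show ?case
    using Cons.IH l w z quantum_class_word_closed[OF w(1), of q] quantum_class_word_closed[OF w(2), of q']
    by (simp add: quantum_class_Cons quantum_gen_closed
        pure_tensor_mult[OF A.calgebra_axioms B.calgebra_axioms])
qed

text \<open>The pullback of \<open>tensor_coeff\<close> along the Segre map. A word goes to the
  tensor of its row word and its column word, and each of these contributes its sorted form with its
  own reordering scalar.\<close>

definition segre_coeff :: "nat list \<Rightarrow> nat list \<Rightarrow> ((nat \<times> nat) list \<Rightarrow>\<^sub>0 complex) \<Rightarrow> complex" where
  "segre_coeff u v = linear_form (\<lambda>w.
     (if sort (map fst w) = u then reorder_coeff q (map fst w) else 0) *
     (if sort (map snd w) = v then reorder_coeff q' (map snd w) else 0))"

text \<open>Since \<open>tensor_coeff\<close> acts on representatives and not on cosets, a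
  representative of the image is carried through the induction together with all its coefficients.
  For a word it is a multiple of a single pair of classes.\<close>

lemma segre_map_representative:
  assumes "p \<in> carrier (free_algebra Z)"
  shows "\<exists>P \<in> carrier (monoid_algebra (A \<times>\<times> B)).
    s (quantum_class Z g p) = tensor_ideal A B +>\<^bsub>monoid_algebra (A \<times>\<times> B)\<^esub> P \<and>
    (\<forall>u v. tensor_coeff {..n} {..m} u v P = segre_coeff u v p)"
  using assms
proof (induction p rule: free_induct)
  note M = ma_calgebra[OF tensor_monoid[OF A.calgebra_axioms B.calgebra_axioms]]
  note J = tensor_ideal_ideal[OF A.calgebra_axioms B.calgebra_axioms]
  let ?M = "monoid_algebra (A \<times>\<times> B)"
  {
    case zero
    have "s (quantum_class Z g 0) = tensor_ideal A B +>\<^bsub>?M\<^esub> 0"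
      using s.hom_zero quot_zero[OF M J] by (simp add: quantum_zero tensor_algebra_def)
    then show ?case
      by (intro bexI[of _ 0]) (auto simp: tensor_coeff_def segre_coeff_def)
  next
    case (single w c)
    have w: "map fst w \<in> lists {..n}" "map snd w \<in> lists {..m}"
      using single by (auto simp: segre_index_def in_lists_conv_set)
    let ?a = "quantum_class {..n} q (Poly_Mapping.single (map fst w) 1)"
    let ?b = "quantum_class {..m} q' (Poly_Mapping.single (map snd w) 1)"
    have ab: "?a \<in> carrier A" "?b \<in> carrier B" using w by (auto simp: quantum_carrier)
    have "quantum_class Z g (Poly_Mapping.single w 1) \<in> carrier Q"
      using single by (auto simp: quantum_carrier)
    then have "s (quantum_class Z g (Poly_Mapping.single w c)) = c \<odot>\<^bsub>T\<^esub> pure_tensor A B ?a ?b"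
      using quantum_class_smult[of "Poly_Mapping.single w 1" Z g c] single
      by (simp add: calg_homD(5)[OF segre_map_hom] segre_map_word)
    also have "\<dots> = tensor_ideal A B +>\<^bsub>?M\<^esub> Poly_Mapping.single (?a, ?b) c"
      unfolding tensor_algebra_def pure_tensor_def
      by (subst quot_sm[OF M J]) (use ab in auto)
    finally show ?case
      using ab w by (intro bexI[of _ "Poly_Mapping.single (?a, ?b) c"])
        (auto simp: tensor_coeff_def segre_coeff_def ordered_form_class lookup_single when_def)
  next
    case (add p r)
    then obtain P R where P: "P \<in> carrier ?M"
        "s (quantum_class Z g p) = tensor_ideal A B +>\<^bsub>?M\<^esub> P"
        "\<And>u v. tensor_coeff {..n} {..m} u v P = segre_coeff u v p"
      and R: "R \<in> carrier ?M"
        "s (quantum_class Z g r) = tensor_ideal A B +>\<^bsub>?M\<^esub> R"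
        "\<And>u v. tensor_coeff {..n} {..m} u v R = segre_coeff u v r" by blast
    have "quantum_class Z g p \<in> carrier Q" "quantum_class Z g r \<in> carrier Q"
      using add.hyps by (auto simp only: quantum_carrier)
    then have "s (quantum_class Z g (p + r)) = tensor_ideal A B +>\<^bsub>?M\<^esub> (P + R)"
      using add.hyps P R quot_add[OF M J P(1) R(1)]
      by (simp only: quantum_class_add calg_homD(3)[OF segre_map_hom]) (simp add: tensor_algebra_def)
    moreover have "P + R \<in> carrier ?M" using P R by (simp add: keys_plusI)
    ultimately show ?case
      using P(3) R(3) by (intro bexI[of _ "P + R"])
        (auto simp: tensor_coeff_def segre_coeff_def linear_form_add)
  }
qed

text \<open>A representative of a zero image lies in \<open>tensor_ideal\<close>, where every
  coefficient functional vanishes.\<close>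

lemma segre_coeff_kernel:
  assumes p: "p \<in> carrier (free_algebra Z)"
    and k: "quantum_class Z g p \<in> a_kernel Q T s"
  shows "segre_coeff u v p = 0"
proof -
  note M = ma_calgebra[OF tensor_monoid[OF A.calgebra_axioms B.calgebra_axioms]]
  note J = tensor_ideal_ideal[OF A.calgebra_axioms B.calgebra_axioms]
  interpret M: calgebra "monoid_algebra (A \<times>\<times> B)" by (rule M)
  let ?M = "monoid_algebra (A \<times>\<times> B)"
  obtain P where P: "P \<in> carrier ?M" "s (quantum_class Z g p) = tensor_ideal A B +>\<^bsub>?M\<^esub> P"
    "\<And>u v. tensor_coeff {..n} {..m} u v P = segre_coeff u v p"
    using segre_map_representative[OF p] by blast
  have "s (quantum_class Z g p) = \<zero>\<^bsub>T\<^esub>" using k unfolding a_kernel_def' by blast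
  then have "tensor_ideal A B +>\<^bsub>?M\<^esub> P = tensor_ideal A B +>\<^bsub>?M\<^esub> 0"
    using P(2) quot_zero[OF M J] by (simp add: tensor_algebra_def)
  then have "P \<ominus>\<^bsub>?M\<^esub> \<zero>\<^bsub>?M\<^esub> \<in> tensor_ideal A B"
    using quot_eq_iff[OF M J P(1), of 0] by simp
  then have "P \<in> tensor_ideal A B"
    using ma_minus[OF tensor_monoid[OF A.calgebra_axioms B.calgebra_axioms], of P 0] P(1) by simp
  then show ?thesis using tensor_coeff_ideal P(3) by metis
qed

section \<open>The quadratic binomials\<close>

lemma segre_binomial_keys:
  assumes "x \<in> I" "x = ((i, j), (\<alpha>, \<beta>))"
  shows "Poly_Mapping.keys (segre_binomial q' x) = {[(i, \<beta>), (j, \<alpha>)], [(i, \<alpha>), (j, \<beta>)]}"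
    "Poly_Mapping.lookup (segre_binomial q' x) [(i, \<beta>), (j, \<alpha>)] = 1"
    "Poly_Mapping.keys (segre_binomial q' x) \<subseteq> ordered_monomials Z"
    "segre_binomial q' x \<in> carrier (free_algebra Z)"
proof -
  have l: "i < j" "j \<le> n" "\<alpha> < \<beta>" "\<beta> \<le> m" using assms by (auto simp: increasing_pairs_def)
  have "\<alpha> \<le> m" using l by simp
  \<comment> \<open>Entries of an anti-symmetric matrix are invertible, so the second term of the
    binomial does not vanish.\<close>
  then have "q' \<beta> \<alpha> \<noteq> 0" using q' l(4) unfolding mult_antisym_def by blast
  then show k: "Poly_Mapping.keys (segre_binomial q' x) = {[(i, \<beta>), (j, \<alpha>)], [(i, \<alpha>), (j, \<beta>)]}"
    using l assms(2) keys_binomial[of "[(i, \<beta>), (j, \<alpha>)]" "[(i, \<alpha>), (j, \<beta>)]" "q' \<beta> \<alpha>"]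
    by (simp add: segre_binomial_def)
  show "Poly_Mapping.lookup (segre_binomial q' x) [(i, \<beta>), (j, \<alpha>)] = 1"
    using l assms by (simp add: segre_binomial_def lookup_minus lookup_single when_def)
  show o: "Poly_Mapping.keys (segre_binomial q' x) \<subseteq> ordered_monomials Z"
    unfolding k using l by (auto simp: ordered_monomials_def segre_index_def)
  then show "segre_binomial q' x \<in> carrier (free_algebra Z)"
    using ordered_monomials_lists by auto
qed

lemma segre_binomial_ordered_form:
  assumes "x \<in> I"
  shows "ordered_form Z (b x) = segre_binomial q' x"
proof -
  obtain i j \<alpha> \<beta> where x: "x = ((i, j), (\<alpha>, \<beta>))" by (metis surj_pair)
  from segre_binomial_keys[OF assms x] show ?thesis by (simp only: ordered_form_class reorder_ordered)
qed

text \<open>Both words have the rows \<open>i\<close>, \<open>j\<close> in this order, so the first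
  columns decide, and \<beta> exceeds \<alpha>.\<close>

lemma segre_binomial_leading:
  assumes "x \<in> I" "x = ((i, j), (\<alpha>, \<beta>))"
  shows "leading_monomial Z (b x) = [(i, \<beta>), (j, \<alpha>)]"
proof (rule leading_monomial_eq)
  note k = segre_binomial_keys(1)[OF assms] segre_binomial_ordered_form[OF assms(1)]
  show "[(i, \<beta>), (j, \<alpha>)] \<in> Poly_Mapping.keys (ordered_form Z (b x))" unfolding k(2) k(1) by simp
  fix v assume "v \<in> Poly_Mapping.keys (ordered_form Z (b x))" "v \<noteq> [(i, \<beta>), (j, \<alpha>)]"
  then have "v = [(i, \<alpha>), (j, \<beta>)]" unfolding k(2) k(1) by simp
  then show "(v, [(i, \<beta>), (j, \<alpha>)]) \<in> deglex"
    using assms by (auto simp: deglex_def lenlex_conv less_prod_def increasing_pairs_def)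
qed

lemma segre_binomial_monic:
  assumes "x \<in> I"
  shows "monic Z g (b x)" "b x \<noteq> \<zero>\<^bsub>Q\<^esub>"
proof -
  obtain i j \<alpha> \<beta> where x: "x = ((i, j), (\<alpha>, \<beta>))" by (metis surj_pair)
  note k = segre_binomial_keys[OF assms x]
  show ne: "b x \<noteq> \<zero>\<^bsub>Q\<^esub>"
  proof
    assume "b x = \<zero>\<^bsub>Q\<^esub>"
    then have "segre_binomial q' x = reorder g 0"
      using segre_binomial_ordered_form[OF assms] ordered_form_class[of 0 Z g] by (simp add: quantum_zero)
    then show False using k(2) by simp
  qed
  then show "monic Z g (b x)"
    by (simp add: monic_def segre_binomial_ordered_form[OF assms] segre_binomial_leading[OF assms x] k(2))
qed

lemma quantum_class_pair:
  assumes "z \<in> Z" "z' \<in> Z"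
  shows "quantum_class Z g (Poly_Mapping.single [z, z'] c) = c \<odot>\<^bsub>Q\<^esub> (quantum_gen Z g z \<otimes>\<^bsub>Q\<^esub> quantum_gen Z g z')"
  using quantum_class_smult[of "Poly_Mapping.single [z, z'] 1" Z g c] assms
  by (simp add: quantum_class_Cons quantum_class_gen)

lemma segre_binomial_class:
  assumes "x \<in> I" "x = ((i, j), (\<alpha>, \<beta>))"
  shows "b x = segre_gen n m q q' i \<beta> \<otimes>\<^bsub>Q\<^esub> segre_gen n m q q' j \<alpha>
        \<ominus>\<^bsub>Q\<^esub> (q' \<beta> \<alpha> \<odot>\<^bsub>Q\<^esub> (segre_gen n m q q' i \<alpha> \<otimes>\<^bsub>Q\<^esub> segre_gen n m q q' j \<beta>))"
proof -
  have z: "(i, \<alpha>) \<in> Z" "(i, \<beta>) \<in> Z" "(j, \<alpha>) \<in> Z" "(j, \<beta>) \<in> Z"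
    using assms by (auto simp: increasing_pairs_def segre_index_def)
  note gc = z[THEN quantum_gen_closed[where q = g]]
  let ?p = "Poly_Mapping.single [(i, \<beta>), (j, \<alpha>)] (1::complex)"
  let ?r = "Poly_Mapping.single [(i, \<alpha>), (j, \<beta>)] (- q' \<beta> \<alpha>)"
  have "segre_binomial q' x = ?p + ?r"
    using assms(2) by (simp add: segre_binomial_def flip: single_uminus)
  moreover have "?p \<in> carrier (free_algebra Z)" "?r \<in> carrier (free_algebra Z)" using z by auto
  ultimately have "b x = quantum_class Z g ?p \<oplus>\<^bsub>Q\<^esub> quantum_class Z g ?r" by (simp only: quantum_class_add)
  moreover have "(- q' \<beta> \<alpha>) \<odot>\<^bsub>Q\<^esub> y = \<ominus>\<^bsub>Q\<^esub> (q' \<beta> \<alpha> \<odot>\<^bsub>Q\<^esub> y)" if "y \<in> carrier Q" for y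
    using that Q.sm_assoc[OF that, of "-1" "q' \<beta> \<alpha>"] Q.sm_uminus[of "q' \<beta> \<alpha> \<odot>\<^bsub>Q\<^esub> y"] by simp
  ultimately show ?thesis
    using gc by (simp add: quantum_class_pair[OF z(2,3)] quantum_class_pair[OF z(1,4)] Q.minus_eq)
qed

lemma segre_relations_eq: "segre_relations n m q q' = (\<lambda>x. b x) ` I"
proof -
  have "segre_relations n m q q' = {b ((i, j), (\<alpha>, \<beta>)) | i j \<alpha> \<beta>. ((i, j), (\<alpha>, \<beta>)) \<in> I}"
    unfolding segre_relations_def
    by (intro Collect_cong ex_cong1) (auto simp: segre_binomial_class increasing_pairs_def)
  then show ?thesis by force
qed

text \<open>All four indices can be read off the leading word, so the index set parametrises the
  relations without repetition.\<close>

lemma segre_binomial_leading_inj: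
  assumes "x \<in> I" "y \<in> I" "leading_monomial Z (b x) = leading_monomial Z (b y)"
  shows "x = y"
proof -
  obtain i j \<alpha> \<beta> where x: "x = ((i, j), (\<alpha>, \<beta>))" by (metis surj_pair)
  obtain i' j' \<alpha>' \<beta>' where y: "y = ((i', j'), (\<alpha>', \<beta>'))" by (metis surj_pair)
  show ?thesis
    using assms(3) x y segre_binomial_leading[OF assms(1) x] segre_binomial_leading[OF assms(2) y] by simp
qed

text \<open>The two monomials have the same row word, and exchanging the columns in the second
  tensor factor produces exactly the scalar \<open>q' \<beta> \<alpha>\<close>.\<close>

lemma segre_binomial_kernel:
  assumes "x \<in> I"
  shows "b x \<in> a_kernel Q T s"
proof -
  obtain i j \<alpha> \<beta> where x: "x = ((i, j), (\<alpha>, \<beta>))" by (metis surj_pair)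
  have l: "i \<le> n" "j \<le> n" "\<alpha> \<le> m" "\<beta> \<le> m" using assms x by (auto simp: increasing_pairs_def)
  let ?x = "quantum_gen {..n} q" and ?y = "quantum_gen {..m} q'"
  note AB = A.calgebra_axioms B.calgebra_axioms
  have c: "?x i \<in> carrier A" "?x j \<in> carrier A" "?y \<alpha> \<in> carrier B" "?y \<beta> \<in> carrier B"
    using l by (auto intro: quantum_gen_closed)
  have z: "segre_gen n m q q' k \<gamma> \<in> carrier Q" if "k \<le> n" "\<gamma> \<le> m" for k \<gamma>
    using that by (auto intro: quantum_gen_closed simp: segre_index_def)
  have sg: "s (segre_gen n m q q' k \<gamma>) = pure_tensor A B (?x k) (?y \<gamma>)" if "k \<le> n" "\<gamma> \<le> m" for k \<gamma>
    using segre_map[OF q q'] that by (simp add: is_segre_map_def)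
  let ?u = "segre_gen n m q q' i \<beta> \<otimes>\<^bsub>Q\<^esub> segre_gen n m q q' j \<alpha>"
  let ?v = "segre_gen n m q q' i \<alpha> \<otimes>\<^bsub>Q\<^esub> segre_gen n m q q' j \<beta>"
  have uv: "?u \<in> carrier Q" "?v \<in> carrier Q" using z l by auto
  have "s ?u = pure_tensor A B (?x i \<otimes>\<^bsub>A\<^esub> ?x j) (?y \<beta> \<otimes>\<^bsub>B\<^esub> ?y \<alpha>)"
    using l c z by (simp add: sg pure_tensor_mult[OF AB])
  also have "?y \<beta> \<otimes>\<^bsub>B\<^esub> ?y \<alpha> = q' \<beta> \<alpha> \<odot>\<^bsub>B\<^esub> (?y \<alpha> \<otimes>\<^bsub>B\<^esub> ?y \<beta>)"
    by (rule quantum_gen_rel'[OF q' l(3,4)])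
  also have "pure_tensor A B (?x i \<otimes>\<^bsub>A\<^esub> ?x j) \<dots> = q' \<beta> \<alpha> \<odot>\<^bsub>T\<^esub> s ?v"
    using l c z by (simp add: sg pure_tensor_mult[OF AB] pure_tensor_sm[OF AB])
  finally have "s ?u = s (q' \<beta> \<alpha> \<odot>\<^bsub>Q\<^esub> ?v)"
    using uv by (simp add: calg_homD(5)[OF segre_map_hom])
  moreover have "s (?u \<ominus>\<^bsub>Q\<^esub> q' \<beta> \<alpha> \<odot>\<^bsub>Q\<^esub> ?v) = s ?u \<ominus>\<^bsub>T\<^esub> s (q' \<beta> \<alpha> \<odot>\<^bsub>Q\<^esub> ?v)"
    using uv by (simp add: Q.minus_eq T.minus_eq)
  ultimately have "s (b x) = \<zero>\<^bsub>T\<^esub>"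
    using segre_binomial_class[OF assms x] uv by (simp add: T.minus_eq T.r_neg)
  moreover have "b x \<in> carrier Q"
    using segre_binomial_class[OF assms x] uv by simp
  ultimately show ?thesis unfolding a_kernel_def' by blast
qed

text \<open>If the leading monomial \<open>w\<close> of an element of the kernel had sorted columns, it would be the
  smallest monomial with its image, so no other term could cancel its contribution.\<close>

lemma segre_kernel_leading:
  assumes h: "h \<in> a_kernel Q T s" "h \<noteq> \<zero>\<^bsub>Q\<^esub>"
  shows "\<not> sorted (map snd (leading_monomial Z h))"
proof
  assume sn: "sorted (map snd (leading_monomial Z h))"
  have hc: "h \<in> carrier Q" using h(1) unfolding a_kernel_def' by blast
  define p where "p = ordered_form Z h"
  note p = quantum_class_ordered_form[OF hc, folded p_def]
  have pc: "p \<in> carrier (free_algebra Z)" using p(2) ordered_monomials_lists by auto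
  have "p \<noteq> 0" using p(1) h(2) by (auto simp: quantum_zero)
  then have lm: "leading_monomial Z h \<in> Poly_Mapping.keys p"
    "\<And>v. v \<in> Poly_Mapping.keys p \<Longrightarrow> v \<noteq> leading_monomial Z h \<Longrightarrow> (v, leading_monomial Z h) \<in> deglex"
    using leading_monomial_max[of Z h] unfolding p_def by blast+
  define w where "w = leading_monomial Z h"
  note lm = lm[folded w_def] and sn = sn[folded w_def]
  have sorted_fst: "sorted (map fst v)" if "v \<in> Poly_Mapping.keys p" for v
    using that p(2) by (intro sorted_map_fst) (auto simp: ordered_monomials_def)
  \<comment> \<open>For \<open>v = w\<close> both reordering scalars are 1. Any other term with the
    same multisets of rows and columns would exceed \<open>w\<close> by
    \<open>deglex_sorted_components_least\<close>, against the maximality of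
    \<open>w\<close>.\<close>
  have contribution: "(if sort (map fst v) = map fst w then reorder_coeff q (map fst v) else 0) *
      (if sort (map snd v) = map snd w then reorder_coeff q' (map snd v) else 0) =
      (if v = w then 1 else 0)" if v: "v \<in> Poly_Mapping.keys p" for v
  proof (cases "v = w")
    case True
    then show ?thesis using sn sorted_fst[OF lm(1)] by (simp add: sorted_sort_id reorder_coeff_sorted)
  next
    case False
    have "\<not> (sort (map fst v) = map fst w \<and> sort (map snd v) = map snd w)"
    proof
      assume e: "sort (map fst v) = map fst w \<and> sort (map snd v) = map snd w"
      have "mset (map fst w) = mset (map fst v)" "mset (map snd w) = mset (map snd v)"
        using e by (metis mset_sort)+
      moreover have "sorted v" using p(2) v by (auto simp: ordered_monomials_def)
      ultimately have "(w, v) \<in> deglex"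
        using deglex_sorted_components_least[of v w] sorted_fst[OF lm(1)] sn False by blast
      then show False using lm(2)[OF v False] deglex_asym by blast
    qed
    then show ?thesis using False by auto
  qed
  \<comment> \<open>The functional chosen from the rows and columns of \<open>w\<close> therefore
    reads off the coefficient of \<open>w\<close>, yet it vanishes on the kernel.\<close>
  have "segre_coeff (map fst w) (map snd w) p = (\<Sum>v\<in>Poly_Mapping.keys p. if v = w then Poly_Mapping.lookup p w else 0)"
    unfolding segre_coeff_def linear_form_def by (rule sum.cong) (auto simp: contribution)
  also have "\<dots> = Poly_Mapping.lookup p w" using lm(1) by simp
  finally have "Poly_Mapping.lookup p w = 0"
    using segre_coeff_kernel[OF pc, of "map fst w" "map snd w"] h(1) p(1) by simp
  then show False using lm(1) by (simp add: in_keys_iff)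
qed

section \<open>Groebner basis, minimality and reducedness\<close>

lemma segre_groebner_basis: "groebner_basis Z g (a_kernel Q T s) ((\<lambda>x. b x) ` I)"
  unfolding groebner_basis_def
proof (intro conjI ballI impI)
  show "ideal (a_kernel Q T s) Q" by (rule s.kernel_is_ideal)
  show "(\<lambda>x. b x) ` I \<subseteq> a_kernel Q T s" using segre_binomial_kernel by blast
  show "monic Z g f" if "f \<in> (\<lambda>x. b x) ` I" for f using that segre_binomial_monic(1) by blast
  fix h assume h: "h \<in> a_kernel Q T s" "h \<noteq> \<zero>\<^bsub>Q\<^esub>"
  have hc: "h \<in> carrier Q" using h(1) unfolding a_kernel_def' by blast
  define w where "w = leading_monomial Z h"
  have "ordered_form Z h \<noteq> 0" using quantum_class_ordered_form(1)[OF hc] h(2) quantum_zero by metis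
  then have w: "w \<in> ordered_monomials Z"
    using leading_monomial_max(1)[of Z h] quantum_class_ordered_form(2)[OF hc] w_def by blast
  then have "sorted w" by (simp add: ordered_monomials_def)
  \<comment> \<open>The inversion supplies the indices of a binomial whose leading word is contained
    in \<open>w\<close>.\<close>
  from obtain_inversion[OF this segre_kernel_leading[OF h, folded w_def]]
  obtain i j \<alpha> \<beta> where ij: "i < j" "\<alpha> < \<beta>" "mset [(i, \<beta>), (j, \<alpha>)] \<subseteq># mset w" by blast
  \<comment> \<open>The inversion alone does not bound the indices; \<open>j \<le> n\<close> and
    \<open>\<beta> \<le> m\<close> hold because the letters of \<open>w\<close> belong to the index
    set.\<close>
  have "set [(i, \<beta>), (j, \<alpha>)] \<subseteq> set w" using set_mset_mono[OF ij(3)] by simp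
  then have "(i, \<beta>) \<in> Z" "(j, \<alpha>) \<in> Z" using w by (auto simp: ordered_monomials_def)
  then have x: "((i, j), (\<alpha>, \<beta>)) \<in> I" using ij by (auto simp: increasing_pairs_def segre_index_def)
  from star_quotient[OF w ij(3)] obtain u where "u \<in> ordered_monomials Z" "w = star u [(i, \<beta>), (j, \<alpha>)]" by blast
  then have "\<exists>u\<in>ordered_monomials Z. leading_monomial Z h = star u (leading_monomial Z (b ((i, j), (\<alpha>, \<beta>))))"
    unfolding segre_binomial_leading[OF x refl] w_def by blast
  then show "\<exists>f\<in>(\<lambda>x. b x) ` I. \<exists>u\<in>ordered_monomials Z. leading_monomial Z h = star u (leading_monomial Z f)"
    by (rule bexI[OF _ imageI[OF x]])
qed

text \<open>All words involved are quadratic, so divisibility by a leading monomial means equality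
  with it. Leading words have decreasing columns, which excludes the lower term of \<open>x\<close>,
  and equality with the leading word of \<open>x\<close> forces \<open>y = x\<close>. The leading
  word serves minimality; both words serve reducedness.\<close>

lemma segre_binomial_normal:
  assumes x: "x \<in> I" and w: "w \<in> Poly_Mapping.keys (segre_binomial q' x)"
  shows "normal_modulo Z ((\<lambda>x. b x) ` I - {b x}) w"
  unfolding normal_modulo_def
proof (intro conjI notI; (elim bexE)?)
  obtain i j \<alpha> \<beta> where xe: "x = ((i, j), (\<alpha>, \<beta>))" by (metis surj_pair)
  note k = segre_binomial_keys[OF x xe]
  show "w \<in> ordered_monomials Z" using k(3) w by blast
  fix u f assume "f \<in> (\<lambda>x. b x) ` I - {b x}" and e: "w = star u (leading_monomial Z f)"
  then obtain y where y: "y \<in> I" "f = b y" "y \<noteq> x" by blast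
  obtain i' j' \<alpha>' \<beta>' where ye: "y = ((i', j'), (\<alpha>', \<beta>'))" by (metis surj_pair)
  have l: "leading_monomial Z f = [(i', \<beta>'), (j', \<alpha>')]" "i' < j'" "\<alpha>' < \<beta>'" "\<alpha> < \<beta>"
    using segre_binomial_leading[OF y(1) ye] y(1,2) ye x xe by (auto simp: increasing_pairs_def)
  have "w = leading_monomial Z f"
  proof (rule star_eq_length[OF e])
    show "length w = length (leading_monomial Z f)" using w unfolding k(1) l(1) by auto
    show "sorted (leading_monomial Z f)" unfolding l(1) using l(2) by (simp add: less_eq_prod_def)
  qed
  then have "[(i', \<beta>'), (j', \<alpha>')] \<in> {[(i, \<beta>), (j, \<alpha>)], [(i, \<alpha>), (j, \<beta>)]}"
    using w unfolding k(1) l(1) by simp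
  then show False using l(3,4) y(3) xe ye by auto
qed

lemma segre_minimal_groebner_basis: "minimal_groebner_basis Z g (a_kernel Q T s) ((\<lambda>x. b x) ` I)"
  unfolding minimal_groebner_basis_def
proof (intro conjI segre_groebner_basis ballI notI)
  fix f assume "f \<in> (\<lambda>x. b x) ` I" and gb: "groebner_basis Z g (a_kernel Q T s) ((\<lambda>x. b x) ` I - {f})"
  then obtain x where x: "x \<in> I" "f = b x" by blast
  obtain i j \<alpha> \<beta> where xe: "x = ((i, j), (\<alpha>, \<beta>))" by (metis surj_pair)
  have "leading_monomial Z f \<in> Poly_Mapping.keys (segre_binomial q' x)"
    using segre_binomial_keys(1)[OF x(1) xe] segre_binomial_leading[OF x(1) xe] x(2) by simp
  then have "normal_modulo Z ((\<lambda>x. b x) ` I - {f}) (leading_monomial Z f)"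
    using segre_binomial_normal x by blast
  moreover have "f \<in> a_kernel Q T s" "f \<noteq> \<zero>\<^bsub>Q\<^esub>"
    unfolding x(2) by (rule segre_binomial_kernel[OF x(1)], rule segre_binomial_monic(2)[OF x(1)])
  then obtain f' u where "f' \<in> (\<lambda>x. b x) ` I - {f}" "u \<in> ordered_monomials Z"
    "leading_monomial Z f = star u (leading_monomial Z f')"
    using gb unfolding groebner_basis_def by meson
  ultimately show False unfolding normal_modulo_def by blast
qed

end

theorem theorem6p10:
  fixes n m :: nat and q q' :: "nat \<Rightarrow> nat \<Rightarrow> complex"
  assumes "mult_antisym n q" and "mult_antisym m q'"
  shows "reduced_groebner_basis (segre_index n m) (segre_matrix q q')
           (a_kernel (segre_source n m q q') (segre_target n m q q') (segre_map n m q q'))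
           (segre_relations n m q q')
       \<and> card (segre_relations n m q q') = ((n + 1) choose 2) * ((m + 1) choose 2)
       \<and> (\<forall>f\<in>segre_relations n m q q'. quadratic_binomial (segre_index n m) f)"
proof (intro conjI ballI)
  let ?I = "increasing_pairs n \<times> increasing_pairs m"
  let ?b = "\<lambda>x. quantum_class (segre_index n m) (segre_matrix q q') (segre_binomial q' x)"
  note F = segre_relations_eq[OF assms]
  show "reduced_groebner_basis (segre_index n m) (segre_matrix q q')
           (a_kernel (segre_source n m q q') (segre_target n m q q') (segre_map n m q q'))
           (segre_relations n m q q')"
    unfolding F reduced_groebner_basis_def
    using segre_minimal_groebner_basis[OF assms] segre_binomial_normal[OF assms]
    by (auto simp: segre_binomial_ordered_form[OF assms])
  \<comment> \<open>Distinct index pairs give distinct leading monomials, so counting relations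
    amounts to counting index pairs.\<close>
  have "inj_on ?b ?I"
    using segre_binomial_leading_inj[OF assms] by (intro inj_onI) metis
  then show "card (segre_relations n m q q') = ((n + 1) choose 2) * ((m + 1) choose 2)"
    unfolding F by (simp add: card_image card_cartesian_product card_increasing_pairs)
  fix f assume "f \<in> segre_relations n m q q'"
  then obtain x where x: "x \<in> ?I" "f = ?b x" unfolding F by blast
  obtain i j \<alpha> \<beta> where xe: "x = ((i, j), (\<alpha>, \<beta>))" by (metis surj_pair)
  \<comment> \<open>This makes the two words of the binomial different, so its support has exactly
    two elements.\<close>
  have "\<alpha> \<noteq> \<beta>" using x xe by (auto simp: increasing_pairs_def)
  then show "quadratic_binomial (segre_index n m) f"
    using x(2) segre_binomial_keys(1)[OF assms x(1) xe] segre_binomial_ordered_form[OF assms x(1)]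
    by (simp add: quadratic_binomial_def)
qed

end
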